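(* Let $G=G_+G_-$ be a unique factorization of a finite group $G$, and let $\xi,\eta:G_+\to G_-$ be group homomorphisms satisfying, for all $u,v\in G_+$ and $x\in G_-$, $$\xi(u)^v=\xi(u^{\eta(v)}),\quad {}^u\eta(v)=\eta({}^{\xi(u)}v),\quad uv=({}^{\xi(u)}v)(u^{\eta(v)}),\quad \xi({}^xu)x^u=x\xi(u),\quad \eta({}^xu)x^u=x\eta(u),$$ so that $$R(\xi,\eta)=\sum_{u,v\in G_+}\{u(\eta(v)^u)^{-1}\}\otimes\{v\xi(u)\}$$ is a positive quasitriangular structure on the Hopf algebra $H(G;G_+,G_-)$ over $\mathbb{C}$. Then $R(\xi,\eta)$ is pseudotriangular if and only if the following conditions hold for all $u,v,s\in G_+$: $$\xi(u)\big(\eta({}^{\eta(v)}u)^{(v^{\xi(u)})}\big)^{-1}=\xi(c)\big(\eta({}^{\eta(v)}c)^{(v^{\xi(c)})}\big)^{-1},$$ $$(\eta(v)^u)^{-1}\xi(v^{\xi(u)})\xi(s)\big(\eta({}^{\eta(t)}s)^{(t^{\xi(s)})}\big)^{-1}=\xi(s)\big(\eta({}^{\eta(u)}s)^{(u^{\xi(s)})}\big)^{-1}(\eta(v)^c)^{-1}\xi(v^{\xi(c)}),$$ $$(\eta(t)^s)^{-1}\xi(t^{\xi(s)})=(\eta(u)^s)^{-1}\xi(u^{\xi(s)}),$$ where $t=u^{(\eta(v)^u)^{-1}\xi(v^{\xi(u)})}$ and $c=u^{\xi(s)\left(\eta({}^{\eta(u)}s)^{(u^{\xi(s)})}\ri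ght)^{-1}}$.
   Context: The base field is $\mathbb{C}$. A unique factorization $G=G_+G_-$ of a group $G$ (with unit $e$) consists of two subgroups $G_+,G_-$ such that every $g\in G$ can be written uniquely as $g=g_+g_-$ with $g_+\in G_+$, $g_-\in G_-$; then every $g$ can also be written uniquely as $g=\overline{g}_-\overline{g}_+$ with $\overline{g}_-\in G_-$, $\overline{g}_+\in G_+$. For $u\in G_+$, $x\in G_-$, write uniquely $$xu=({}^xu)(x^u),\ {}^xu\in G_+,\ x^u\in G_-;\qquad ux=({}^ux)(u^x),\ {}^ux\in G_-,\ u^x\in G_+.$$ This defines left and right actions of $G_+$ and $G_-$ on each other. For $G$ finite, $H(G;G_+,G_-)$ is the Hopf algebra with basis $\{g\}$, $g\in G$, and structure: multiplication $\{g\}\{h\}=\delta_{g_+^{g_-},h_+}\{gh_-\}$; unit $1=\sum_{g_+\in G_+}\{g_+\}$; comultiplication $\Delta(\{g\})=\sum_{h_+\in G_+}\{g_+h_+^{-1}({}^{h_+}g_-)\}\otimes\{h_+g_-\}$; counit $\varepsilon(\{g\})=\delta_{g_+,e}$; antipode $S(\{g\})=\{g^{-1}\}$. A quasitriangular structure on it is positive if its coefficients in the basis $\{g\}\otimes\{h\}$ are nonnegative reals; it is known (Lu–Yan–Zhu) that $R(\xi,\eta)$ is a positive quasitriangular structure for every pair $(\xi,\eta)$ as in the claim, and that all positive quasitriangular structures are of this form. A quasitriangular structure $R\in H\otimes H$ on a Hopf algebra $H$ is called pseudotriangular if $R_{12}R^{-1}_{31}R_{23}=R_{23}R^{-1}_{31}R_{12}$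 in $H^{\otimes 3}$, where for $Q=\sum a\otimes b$ one writes $Q_{12}=\sum a\otimes b\otimes 1$, $Q_{23}=\sum 1\otimes a\otimes b$, $Q_{31}=\sum b\otimes 1\otimes a$, and $R^{-1}_{31}=(R^{-1})_{31}$. *)

theory Defs
  imports Complex_Main "HOL-Algebra.Group"
begin

section \<open>Unique factorizations of groups\<close>

record 'a factored_group = "'a monoid" +
  Gplus :: "'a set"
  Gminus :: "'a set"

locale unique_factorization = group G
  for G :: "('a, 'm) factored_group_scheme" (structure) +
  assumes subgroup_Gplus: "subgroup (Gplus G) G"
    and subgroup_Gminus: "subgroup (Gminus G) G"
    and unique_factorization:
      "g \<in> carrier G \<Longrightarrow> \<exists>!(u, x). u \<in> Gplus G \<and> x \<in> Gminus G \<and> g = u \<otimes> x"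

text \<open>\<open>plus_part\<close> and \<open>minus_part\<close> give the factorization of \<open>g\<close> with the factor from
  \<open>Gplus\<close> on the left; the primed versions give the one with the factor from \<open>Gminus\<close> on
  the left.\<close>

definition plus_part :: "('a, 'm) factored_group_scheme \<Rightarrow> 'a \<Rightarrow> 'a" where
  "plus_part G g = (THE u. u \<in> Gplus G \<and> (\<exists>x\<in>Gminus G. g = u \<otimes>\<^bsub>G\<^esub> x))"

definition minus_part :: "('a, 'm) factored_group_scheme \<Rightarrow> 'a \<Rightarrow> 'a" where
  "minus_part G g = (THE x. x \<in> Gminus G \<and> (\<exists>u\<in>Gplus G. g = u \<otimes>\<^bsub>G\<^esub> x))"

definition minus_part' :: "('a, 'm) factored_group_scheme \<Rightarrow> 'a \<Rightarrow> 'a" where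
  "minus_part' G g = (THE x. x \<in> Gminus G \<and> (\<exists>u\<in>Gplus G. g = x \<otimes>\<^bsub>G\<^esub> u))"

definition plus_part' :: "('a, 'm) factored_group_scheme \<Rightarrow> 'a \<Rightarrow> 'a" where
  "plus_part' G g = (THE u. u \<in> Gplus G \<and> (\<exists>x\<in>Gminus G. g = x \<otimes>\<^bsub>G\<^esub> u))"

text \<open>For \<open>u\<close> in \<open>Gplus\<close> and \<open>x\<close> in \<open>Gminus\<close> the four actions are characterized by
  \<open>x u = (x \<triangleright> u) (x \<triangleleft> u)\<close> and \<open>u x = (u \<rightharpoonup> x) (u \<leftharpoonup> x)\<close>. In superscript notation,
  \<open>x \<triangleright> u\<close> and \<open>u \<rightharpoonup> x\<close> are the left actions (left superscripts), and \<open>x \<triangleleft> u\<close> and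
  \<open>u \<leftharpoonup> x\<close> are the right actions (\<open>x\<close> to the power \<open>u\<close>, \<open>u\<close> to the power \<open>x\<close>).
  So \<open>\<triangleright>\<close>, \<open>\<leftharpoonup>\<close> take values in \<open>Gplus\<close> and \<open>\<triangleleft>\<close>, \<open>\<rightharpoonup>\<close> in \<open>Gminus\<close>.\<close>

definition minus_act_left ::
    "('a, 'm) factored_group_scheme \<Rightarrow> 'a \<Rightarrow> 'a \<Rightarrow> 'a" (infixr "\<triangleright>\<index>" 75) where
  "x \<triangleright>\<^bsub>G\<^esub> u = plus_part G (x \<otimes>\<^bsub>G\<^esub> u)"

definition plus_act_right ::
    "('a, 'm) factored_group_scheme \<Rightarrow> 'a \<Rightarrow> 'a \<Rightarrow> 'a" (infixl "\<triangleleft>\<index>" 75) where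
  "x \<triangleleft>\<^bsub>G\<^esub> u = minus_part G (x \<otimes>\<^bsub>G\<^esub> u)"

definition plus_act_left ::
    "('a, 'm) factored_group_scheme \<Rightarrow> 'a \<Rightarrow> 'a \<Rightarrow> 'a" (infixr "\<rightharpoonup>\<index>" 75) where
  "u \<rightharpoonup>\<^bsub>G\<^esub> x = minus_part' G (u \<otimes>\<^bsub>G\<^esub> x)"

definition minus_act_right ::
    "('a, 'm) factored_group_scheme \<Rightarrow> 'a \<Rightarrow> 'a \<Rightarrow> 'a" (infixl "\<leftharpoonup>\<index>" 75) where
  "u \<leftharpoonup>\<^bsub>G\<^esub> x = plus_part' G (u \<otimes>\<^bsub>G\<^esub> x)"


section \<open>Algebras and Hopf algebras with a chosen finite basis\<close>

text \<open>A vector in the complex span of a finite set \<open>B\<close> is a coefficient function vanishing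
  outside \<open>B\<close>; the tensor product of the spans of \<open>B\<close> and \<open>C\<close> is the span of \<open>B \<times> C\<close>.
  Algebras and Hopf algebras are given by their structure maps on basis vectors:
  \<open>basis_mult A a b\<close> is the vector that is the product of the basis vectors \<open>a\<close> and \<open>b\<close>, etc.\<close>

record 'b based_algebra =
  basis :: "'b set"
  basis_mult :: "'b \<Rightarrow> 'b \<Rightarrow> 'b \<Rightarrow> complex"
  alg_unit :: "'b \<Rightarrow> complex"

record 'b based_hopf = "'b based_algebra" +
  basis_comult :: "'b \<Rightarrow> 'b \<times> 'b \<Rightarrow> complex"
  basis_counit :: "'b \<Rightarrow> complex"
  basis_antipode :: "'b \<Rightarrow> 'b \<Rightarrow> complex"

definition basis_vec :: "'b \<Rightarrow> 'b \<Rightarrow> complex" where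
  "basis_vec b = (\<lambda>x. if x = b then 1 else 0)"

definition tensor_vec :: "('b \<Rightarrow> complex) \<Rightarrow> ('c \<Rightarrow> complex) \<Rightarrow> 'b \<times> 'c \<Rightarrow> complex" where
  "tensor_vec f g = (\<lambda>(x, y). f x * g y)"

definition tensor_alg ::
    "('b, 'm) based_algebra_scheme \<Rightarrow> ('c, 'n) based_algebra_scheme \<Rightarrow> ('b \<times> 'c) based_algebra" where
  "tensor_alg A B =
    \<lparr>basis = basis A \<times> basis B,
     basis_mult = (\<lambda>(a, b) (a', b'). tensor_vec (basis_mult A a a') (basis_mult B b b')),
     alg_unit = tensor_vec (alg_unit A) (alg_unit B)\<rparr>"

text \<open>The multiplicative monoid of an algebra; its multiplication is the bilinear extension
  of the multiplication of basis vectors.\<close>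

definition alg_monoid :: "('b, 'm) based_algebra_scheme \<Rightarrow> ('b \<Rightarrow> complex) monoid" where
  "alg_monoid A =
    \<lparr>carrier = {f. \<forall>x. x \<notin> basis A \<longrightarrow> f x = 0},
     mult = (\<lambda>f g x. \<Sum>a\<in>basis A. \<Sum>b\<in>basis A. f a * g b * basis_mult A a b x),
     one = alg_unit A\<rparr>"

abbreviation alg_monoid2 :: "('b, 'm) based_algebra_scheme \<Rightarrow> ('b \<times> 'b \<Rightarrow> complex) monoid" where
  "alg_monoid2 A \<equiv> alg_monoid (tensor_alg A A)"

abbreviation alg_monoid3 ::
    "('b, 'm) based_algebra_scheme \<Rightarrow> ('b \<times> 'b \<times> 'b \<Rightarrow> complex) monoid" where
  "alg_monoid3 A \<equiv> alg_monoid (tensor_alg A (tensor_alg A A))"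

definition comult ::
    "('b, 'm) based_hopf_scheme \<Rightarrow> ('b \<Rightarrow> complex) \<Rightarrow> 'b \<times> 'b \<Rightarrow> complex" where
  "comult H f = (\<lambda>p. \<Sum>a\<in>basis H. f a * basis_comult H a p)"

definition comult_op ::
    "('b, 'm) based_hopf_scheme \<Rightarrow> ('b \<Rightarrow> complex) \<Rightarrow> 'b \<times> 'b \<Rightarrow> complex" where
  "comult_op H f = (\<lambda>(x, y). comult H f (y, x))"

definition comult_id ::
    "('b, 'm) based_hopf_scheme \<Rightarrow> ('b \<times> 'b \<Rightarrow> complex) \<Rightarrow> 'b \<times> 'b \<times> 'b \<Rightarrow> complex" where
  "comult_id H Q = (\<lambda>(x, y, z). \<Sum>a\<in>basis H. Q (a, z) * basis_comult H a (x, y))"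

definition id_comult ::
    "('b, 'm) based_hopf_scheme \<Rightarrow> ('b \<times> 'b \<Rightarrow> complex) \<Rightarrow> 'b \<times> 'b \<times> 'b \<Rightarrow> complex" where
  "id_comult H Q = (\<lambda>(x, y, z). \<Sum>b\<in>basis H. Q (x, b) * basis_comult H b (y, z))"

definition leg12 ::
    "('b, 'm) based_algebra_scheme \<Rightarrow> ('b \<times> 'b \<Rightarrow> complex) \<Rightarrow> 'b \<times> 'b \<times> 'b \<Rightarrow> complex" where
  "leg12 A Q = (\<lambda>(x, y, z). Q (x, y) * alg_unit A z)"

definition leg13 ::
    "('b, 'm) based_algebra_scheme \<Rightarrow> ('b \<times> 'b \<Rightarrow> complex) \<Rightarrow> 'b \<times> 'b \<times> 'b \<Rightarrow> complex" where
  "leg13 A Q = (\<lambda>(x, y, z). Q (x, z) * alg_unit A y)"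

definition leg23 ::
    "('b, 'm) based_algebra_scheme \<Rightarrow> ('b \<times> 'b \<Rightarrow> complex) \<Rightarrow> 'b \<times> 'b \<times> 'b \<Rightarrow> complex" where
  "leg23 A Q = (\<lambda>(x, y, z). alg_unit A x * Q (y, z))"

text \<open>The first tensor factor of \<open>Q\<close> goes to position 3 and the second one to position 1.\<close>

definition leg31 ::
    "('b, 'm) based_algebra_scheme \<Rightarrow> ('b \<times> 'b \<Rightarrow> complex) \<Rightarrow> 'b \<times> 'b \<times> 'b \<Rightarrow> complex" where
  "leg31 A Q = (\<lambda>(x, y, z). Q (z, x) * alg_unit A y)"

definition quasitriangular ::
    "('b, 'm) based_hopf_scheme \<Rightarrow> ('b \<times> 'b \<Rightarrow> complex) \<Rightarrow> bool" where
  "quasitriangular H R \<longleftrightarrow>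
     R \<in> Units (alg_monoid2 H) \<and>
     (\<forall>f\<in>carrier (alg_monoid H).
        comult_op H f = R \<otimes>\<^bsub>alg_monoid2 H\<^esub> comult H f \<otimes>\<^bsub>alg_monoid2 H\<^esub> inv\<^bsub>alg_monoid2 H\<^esub> R) \<and>
     comult_id H R = leg13 H R \<otimes>\<^bsub>alg_monoid3 H\<^esub> leg23 H R \<and>
     id_comult H R = leg13 H R \<otimes>\<^bsub>alg_monoid3 H\<^esub> leg12 H R"

definition pseudotriangular ::
    "('b, 'm) based_hopf_scheme \<Rightarrow> ('b \<times> 'b \<Rightarrow> complex) \<Rightarrow> bool" where
  "pseudotriangular H R \<longleftrightarrow>
     quasitriangular H R \<and>
     leg12 H R \<otimes>\<^bsub>alg_monoid3 H\<^esub> leg31 H (inv\<^bsub>alg_monoid2 H\<^esub> R) \<otimes>\<^bsub>alg_monoid3 H\<^esub> leg23 H R =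
     leg23 H R \<otimes>\<^bsub>alg_monoid3 H\<^esub> leg31 H (inv\<^bsub>alg_monoid2 H\<^esub> R) \<otimes>\<^bsub>alg_monoid3 H\<^esub> leg12 H R"


section \<open>The Hopf algebra of a unique factorization\<close>

definition factorization_hopf :: "('a, 'm) factored_group_scheme \<Rightarrow> 'a based_hopf" where
  "factorization_hopf G =
    \<lparr>basis = carrier G,
     basis_mult = (\<lambda>g h x.
       if plus_part G g \<leftharpoonup>\<^bsub>G\<^esub> minus_part G g = plus_part G h
       then basis_vec (g \<otimes>\<^bsub>G\<^esub> minus_part G h) x else 0),
     alg_unit = (\<lambda>x. \<Sum>u\<in>Gplus G. basis_vec u x),
     basis_comult = (\<lambda>g p. \<Sum>h\<in>Gplus G.
       tensor_vec
         (basis_vec (plus_part G g \<otimes>\<^bsub>G\<^esub> inv\<^bsub>G\<^esub> h \<otimes>\<^bsub>G\<^esub> (h \<rightharpoonup>\<^bsub>G\<^esub> minus_part G g)))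
         (basis_vec (h \<otimes>\<^bsub>G\<^esub> minus_part G g)) p),
     basis_counit = (\<lambda>g. if plus_part G g = \<one>\<^bsub>G\<^esub> then 1 else 0),
     basis_antipode = (\<lambda>g. basis_vec (inv\<^bsub>G\<^esub> g))\<rparr>"

definition R_elem ::
    "('a, 'm) factored_group_scheme \<Rightarrow> ('a \<Rightarrow> 'a) \<Rightarrow> ('a \<Rightarrow> 'a) \<Rightarrow> 'a \<times> 'a \<Rightarrow> complex" where
  "R_elem G \<xi> \<eta> = (\<lambda>p. \<Sum>u\<in>Gplus G. \<Sum>v\<in>Gplus G.
     tensor_vec (basis_vec (u \<otimes>\<^bsub>G\<^esub> inv\<^bsub>G\<^esub> (\<eta> v \<triangleleft>\<^bsub>G\<^esub> u)))
                (basis_vec (v \<otimes>\<^bsub>G\<^esub> \<xi> u)) p)"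

end

theory Submission
  imports Defs
begin

text \<open>
  The Hopf algebra of a unique factorization is the algebra of an action groupoid: the basis vector
  \<open>u \<otimes> x\<close> with \<open>u\<close> in \<open>Gplus\<close> and \<open>x\<close> in \<open>Gminus\<close> is an arrow with label \<open>x\<close> from the object \<open>u\<close> to
  the object \<open>u \<leftharpoonup> x\<close>, and the product of two arrows is their composite, or \<open>0\<close> if they do not compose.
  Its tensor powers are the groupoid algebras of the product actions. An element that is the sum of
  one arrow for each object is called a section here. Sections multiply by following the arrows
  (\<open>section_vec_mult\<close>), and two sections agree iff their labels agree at every object
  (\<open>section_vec_eq_iff\<close>). The element \<open>R\<close> and all its leg placements are sections, so every identity
  between their products becomes a finite list of identities between labels in \<open>Gminus\<close>.

  The labels are controlled by one fact: the map \<open>(q, p) \<mapsto> (\<eta> q \<triangleright> p, q \<leftharpoonup> \<xi> p)\<close>, which tells where \<open>R\<close>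
  moves the object \<open>(p, q)\<close>, is the two-sided inverse of the braiding \<open>(u, v) \<mapsto> (\<xi> u \<triangleright> v, u \<leftharpoonup> \<eta> v)\<close>.
  The compatibility conditions on \<open>\<xi>\<close> and \<open>\<eta>\<close> make it a left inverse, and finiteness does the rest.
  Thus the conditions, which speak about the braiding, can be read backwards (\<open>braiding_inverse\<close>):
  the product of the pair is preserved, \<open>\<xi> (\<eta> q \<triangleright> p) = q \<rightharpoonup> \<xi> p\<close> and \<open>\<eta> (q \<leftharpoonup> \<xi> p) = \<eta> q \<triangleleft> p\<close>. The
  axioms of a quasitriangular structure and the Yang--Baxter equation follow from these identities.

  For pseudotriangularity put \<open>Q = R R21\<close>. In every group the Yang--Baxter equations imply that
  \<open>R12 R31\<inverse> R23 = R23 R31\<inverse> R12\<close> holds iff \<open>Q12\<close> and \<open>Q23\<close> commute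
  (\<open>pseudotriangular_iff_commute\<close>). The labels of \<open>Q\<close> at the object \<open>(u, v)\<close> are
  \<open>inv (\<eta> v \<triangleleft> u) \<otimes> \<xi> (v \<leftharpoonup> \<xi> u)\<close> and \<open>\<xi> u \<otimes> inv (\<eta> (\<eta> v \<triangleright> u) \<triangleleft> (v \<leftharpoonup> \<xi> u))\<close>. Following both products from
  the object \<open>(s, u, v)\<close>, the middle object \<open>u\<close> is moved to \<open>c\<close> when \<open>Q12\<close> acts first and to \<open>t\<close> when
  \<open>Q23\<close> acts first, and the three stated conditions are the equalities of the labels in the third,
  second and first leg.
\<close>

section \<open>Pseudotriangularity and commutation in a group\<close>

context group
begin

text \<open>The point is that each of the two sides differs from a product of \<open>w = r12 \<otimes> inv r31\<close> and
  \<open>q = r23 \<otimes> r32\<close> by the factor \<open>r32\<close> on the right: this is trivial for the left-hand side and the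
  first Yang--Baxter equation for the right-hand side. So the equation says that \<open>w\<close> and \<open>q\<close> commute.
  The other two equations say that \<open>d = r31 \<otimes> r21\<close> commutes with \<open>r23\<close> and \<open>r32\<close> up to reversing \<open>d\<close>,
  hence with \<open>q\<close>, so \<open>w\<close> may be replaced by \<open>w \<otimes> d = r12 \<otimes> r21\<close>.\<close>

lemma pseudotriangular_iff_commute:
  assumes c: "r12 \<in> carrier G" "r21 \<in> carrier G" "r23 \<in> carrier G" "r32 \<in> carrier G" "r31 \<in> carrier G"
    and y1: "r31 \<otimes> r32 \<otimes> r12 = r12 \<otimes> r32 \<otimes> r31"
    and y2: "r23 \<otimes> r21 \<otimes> r31 = r31 \<otimes> r21 \<otimes> r23"
    and y3: "r32 \<otimes> r31 \<otimes> r21 = r21 \<otimes> r31 \<otimes> r32"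
  shows "r12 \<otimes> inv r31 \<otimes> r23 = r23 \<otimes> inv r31 \<otimes> r12 \<longleftrightarrow>
    (r12 \<otimes> r21) \<otimes> (r23 \<otimes> r32) = (r23 \<otimes> r32) \<otimes> (r12 \<otimes> r21)"
proof -
  define q where "q = r23 \<otimes> r32"
  define w where "w = r12 \<otimes> inv r31"
  define d where "d = r31 \<otimes> r21"
  have cl [simp]: "q \<in> carrier G" "w \<in> carrier G" "d \<in> carrier G"
    using c by (auto simp: q_def w_def d_def)
  have qd: "d \<otimes> q = q \<otimes> d"
  proof -
    have "d \<otimes> q = (r31 \<otimes> r21 \<otimes> r23) \<otimes> r32" using c by (simp add: d_def q_def m_assoc)
    also have "\<dots> = r23 \<otimes> (r21 \<otimes> r31 \<otimes> r32)" using c by (simp add: y2 [symmetric] m_assoc)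
    also have "\<dots> = q \<otimes> d" using c by (simp add: y3 [symmetric] d_def q_def m_assoc)
    finally show ?thesis .
  qed
  have "inv r31 \<otimes> r12 \<otimes> r32 = r32 \<otimes> w"
  proof -
    have "inv r31 \<otimes> r12 \<otimes> r32 = inv r31 \<otimes> (r12 \<otimes> r32 \<otimes> r31) \<otimes> inv r31"
      using c by (simp add: m_assoc)
    also have "\<dots> = r32 \<otimes> w"
      using c by (simp add: y1 [symmetric] w_def m_assoc [symmetric])
    finally show ?thesis .
  qed
  hence rhs: "r23 \<otimes> inv r31 \<otimes> r12 \<otimes> r32 = q \<otimes> w" using c by (simp add: q_def m_assoc)
  have lhs: "r12 \<otimes> inv r31 \<otimes> r23 \<otimes> r32 = w \<otimes> q" using c by (simp add: q_def w_def m_assoc)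
  have "r12 \<otimes> inv r31 \<otimes> r23 = r23 \<otimes> inv r31 \<otimes> r12 \<longleftrightarrow> w \<otimes> q = q \<otimes> w"
    unfolding lhs [symmetric] rhs [symmetric] using c by simp
  also have "\<dots> \<longleftrightarrow> (w \<otimes> d) \<otimes> q = q \<otimes> (w \<otimes> d)"
  proof -
    have "(w \<otimes> d) \<otimes> q = (w \<otimes> q) \<otimes> d" by (simp add: m_assoc qd)
    moreover have "q \<otimes> (w \<otimes> d) = (q \<otimes> w) \<otimes> d" by (simp add: m_assoc)
    ultimately show ?thesis by simp
  qed
  also have "w \<otimes> d = r12 \<otimes> r21" using c by (simp add: w_def d_def m_assoc [symmetric]) (simp add: m_assoc)
  finally show ?thesis by (simp add: q_def)
qed

end

section \<open>The mutual actions of a unique factorization\<close>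

context unique_factorization
begin

lemma Gplus_closed [simp]: "u \<in> Gplus G \<Longrightarrow> u \<in> carrier G"
  by (rule subgroup.mem_carrier [OF subgroup_Gplus])

lemma Gminus_closed [simp]: "x \<in> Gminus G \<Longrightarrow> x \<in> carrier G"
  by (rule subgroup.mem_carrier [OF subgroup_Gminus])

lemma Gplus_mult [simp]: "u \<in> Gplus G \<Longrightarrow> v \<in> Gplus G \<Longrightarrow> u \<otimes> v \<in> Gplus G"
  by (rule subgroup.m_closed [OF subgroup_Gplus])

lemma Gminus_mult [simp]: "x \<in> Gminus G \<Longrightarrow> y \<in> Gminus G \<Longrightarrow> x \<otimes> y \<in> Gminus G"
  by (rule subgroup.m_closed [OF subgroup_Gminus])

lemma Gplus_inv [simp]: "u \<in> Gplus G \<Longrightarrow> inv u \<in> Gplus G"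
  by (rule subgroup.m_inv_closed [OF subgroup_Gplus])

lemma Gminus_inv [simp]: "x \<in> Gminus G \<Longrightarrow> inv x \<in> Gminus G"
  by (rule subgroup.m_inv_closed [OF subgroup_Gminus])

lemma Gplus_one [simp]: "\<one> \<in> Gplus G" and Gminus_one [simp]: "\<one> \<in> Gminus G"
  by (rule subgroup.one_closed [OF subgroup_Gplus] subgroup.one_closed [OF subgroup_Gminus])+

lemma factorization_eqD:
  assumes "u \<otimes> x = v \<otimes> y" "u \<in> Gplus G" "x \<in> Gminus G" "v \<in> Gplus G" "y \<in> Gminus G"
  shows "u = v \<and> x = y"
proof -
  have "\<exists>!(a, b). a \<in> Gplus G \<and> b \<in> Gminus G \<and> u \<otimes> x = a \<otimes> b"
    using assms by (intro unique_factorization m_closed Gplus_closed Gminus_closed)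
  then obtain p where p: "\<And>q. (case q of (a, b) \<Rightarrow> a \<in> Gplus G \<and> b \<in> Gminus G \<and> u \<otimes> x = a \<otimes> b) \<Longrightarrow> q = p"
    by (elim ex1E) blast
  have "(u, x) = p" using assms(2,3) by (intro p) simp
  moreover have "(v, y) = p" using assms(1,4,5) by (intro p) simp
  ultimately have "(u, x) = (v, y)" by simp
  thus ?thesis by simp
qed

lemma opposite_factorization_eqD:
  assumes "x \<otimes> u = y \<otimes> v" "u \<in> Gplus G" "x \<in> Gminus G" "v \<in> Gplus G" "y \<in> Gminus G"
  shows "x = y \<and> u = v"
proof -
  have "inv u \<otimes> inv x = inv v \<otimes> inv y"
    using assms by (metis Gminus_closed Gplus_closed inv_mult_group)
  thus ?thesis using factorization_eqD [of "inv u" "inv x" "inv v" "inv y"] assms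
    by (metis Gminus_closed Gminus_inv Gplus_closed Gplus_inv inv_inv)
qed

lemma factorization:
  assumes "g \<in> carrier G"
  obtains u x where "u \<in> Gplus G" "x \<in> Gminus G" "g = u \<otimes> x"
  using unique_factorization [OF assms] by blast

lemma opposite_factorization:
  assumes "g \<in> carrier G"
  obtains x u where "x \<in> Gminus G" "u \<in> Gplus G" "g = x \<otimes> u"
proof -
  obtain u x where "u \<in> Gplus G" "x \<in> Gminus G" "inv g = u \<otimes> x"
    using factorization [of "inv g"] assms by auto
  moreover from this have "g = inv x \<otimes> inv u"
    using assms by (metis Gminus_closed Gplus_closed inv_inv inv_mult_group)
  ultimately show thesis using that [of "inv x" "inv u"] by auto
qed

lemma plus_part_eq [simp]: "u \<in> Gplus G \<Longrightarrow> x \<in> Gminus G \<Longrightarrow> plus_part G (u \<otimes> x) = u"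
  unfolding plus_part_def by (rule the_equality) (auto dest: factorization_eqD)

lemma minus_part_eq [simp]: "u \<in> Gplus G \<Longrightarrow> x \<in> Gminus G \<Longrightarrow> minus_part G (u \<otimes> x) = x"
  unfolding minus_part_def by (rule the_equality) (auto dest: factorization_eqD)

lemma minus_part'_eq: "x \<in> Gminus G \<Longrightarrow> u \<in> Gplus G \<Longrightarrow> minus_part' G (x \<otimes> u) = x"
  unfolding minus_part'_def by (rule the_equality) (auto dest: opposite_factorization_eqD)

lemma plus_part'_eq: "x \<in> Gminus G \<Longrightarrow> u \<in> Gplus G \<Longrightarrow> plus_part' G (x \<otimes> u) = u"
  unfolding plus_part'_def by (rule the_equality) (auto dest: opposite_factorization_eqD)

lemma triangle_eqI:
  assumes "x \<otimes> u = v \<otimes> y" "v \<in> Gplus G" "y \<in> Gminus G"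
  shows "x \<triangleright> u = v" "x \<triangleleft> u = y"
  using assms by (auto simp: minus_act_left_def plus_act_right_def)

lemma harpoon_eqI:
  assumes "u \<otimes> x = y \<otimes> v" "y \<in> Gminus G" "v \<in> Gplus G"
  shows "u \<rightharpoonup> x = y" "u \<leftharpoonup> x = v"
  using assms by (auto simp: plus_act_left_def minus_act_right_def plus_part'_eq minus_part'_eq)

lemma triangle:
  assumes "x \<in> Gminus G" "u \<in> Gplus G"
  shows triangle_plus [simp]: "x \<triangleright> u \<in> Gplus G" and triangle_minus [simp]: "x \<triangleleft> u \<in> Gminus G"
    and triangle_mult: "(x \<triangleright> u) \<otimes> (x \<triangleleft> u) = x \<otimes> u"
proof -
  obtain v y where "v \<in> Gplus G" "y \<in> Gminus G" "x \<otimes> u = v \<otimes> y"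
    using factorization [of "x \<otimes> u"] assms by auto
  with triangle_eqI [of x u v y]
  show "x \<triangleright> u \<in> Gplus G" "x \<triangleleft> u \<in> Gminus G" "(x \<triangleright> u) \<otimes> (x \<triangleleft> u) = x \<otimes> u" by auto
qed

lemma harpoon:
  assumes "u \<in> Gplus G" "x \<in> Gminus G"
  shows harpoon_minus [simp]: "u \<rightharpoonup> x \<in> Gminus G" and harpoon_plus [simp]: "u \<leftharpoonup> x \<in> Gplus G"
    and harpoon_mult: "(u \<rightharpoonup> x) \<otimes> (u \<leftharpoonup> x) = u \<otimes> x"
proof -
  obtain v y where "v \<in> Gplus G" "y \<in> Gminus G" "u \<otimes> x = y \<otimes> v"
    using opposite_factorization [of "u \<otimes> x"] assms by (metis Gminus_closed Gplus_closed m_closed)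
  with harpoon_eqI [of u x y v]
  show "u \<rightharpoonup> x \<in> Gminus G" "u \<leftharpoonup> x \<in> Gplus G" "(u \<rightharpoonup> x) \<otimes> (u \<leftharpoonup> x) = u \<otimes> x" by auto
qed

lemma minus_act_right_one [simp]: "u \<in> Gplus G \<Longrightarrow> u \<leftharpoonup> \<one> = u"
  by (rule harpoon_eqI [where y = \<one>]) auto

text \<open>Both this law and the next one come from moving the \<open>Gminus\<close> factors to the left across the
  \<open>Gplus\<close> factors one at a time and appealing to uniqueness of the factorization.\<close>

lemma minus_act_right_mult:
  assumes "u \<in> Gplus G" "x \<in> Gminus G" "y \<in> Gminus G"
  shows "u \<leftharpoonup> (x \<otimes> y) = u \<leftharpoonup> x \<leftharpoonup> y"
proof (rule harpoon_eqI)
  show "u \<otimes> (x \<otimes> y) = ((u \<rightharpoonup> x) \<otimes> ((u \<leftharpoonup> x) \<rightharpoonup> y)) \<otimes> (u \<leftharpoonup> x \<leftharpoonup> y)"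
    using assms by (simp add: m_assoc harpoon_mult) (simp add: harpoon_mult flip: m_assoc)
qed (use assms in auto)

lemma mult_minus_act_right:
  assumes "u \<in> Gplus G" "v \<in> Gplus G" "x \<in> Gminus G"
  shows "(u \<otimes> v) \<leftharpoonup> x = (u \<leftharpoonup> (v \<rightharpoonup> x)) \<otimes> (v \<leftharpoonup> x)"
proof (rule harpoon_eqI)
  show "u \<otimes> v \<otimes> x = (u \<rightharpoonup> (v \<rightharpoonup> x)) \<otimes> ((u \<leftharpoonup> (v \<rightharpoonup> x)) \<otimes> (v \<leftharpoonup> x))"
    using assms by (simp add: harpoon_mult flip: m_assoc) (simp add: m_assoc harpoon_mult)
qed (use assms in auto)

end

section \<open>Algebras of action groupoids\<close>

lemma sum_basis_vec_mult_weighted: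
  fixes w :: "'d \<Rightarrow> complex"
  assumes "finite B" "finite D" "\<And>d. d \<in> D \<Longrightarrow> p d \<in> B"
  shows "(\<Sum>b\<in>B. (\<Sum>d\<in>D. basis_vec (p d) b * w d) * h b) = (\<Sum>d\<in>D. w d * h (p d))"
proof -
  have "(\<Sum>b\<in>B. (\<Sum>d\<in>D. basis_vec (p d) b * w d) * h b) =
      (\<Sum>d\<in>D. \<Sum>b\<in>B. basis_vec (p d) b * w d * h b)"
    unfolding sum_distrib_right by (rule sum.swap)
  also have "\<dots> = (\<Sum>d\<in>D. \<Sum>b\<in>B. if b = p d then w d * h b else 0)"
    by (intro sum.cong) (auto simp: basis_vec_def)
  also have "\<dots> = (\<Sum>d\<in>D. w d * h (p d))"
    using assms by (intro sum.cong) auto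
  finally show ?thesis .
qed

lemma sum_basis_vec_mult:
  assumes "finite B" "finite D" "\<And>d. d \<in> D \<Longrightarrow> p d \<in> B"
  shows "(\<Sum>b\<in>B. (\<Sum>d\<in>D. basis_vec (p d) b) * h b) = (\<Sum>d\<in>D. h (p d))"
  using sum_basis_vec_mult_weighted [OF assms, where w = "\<lambda>_. 1" and h = h] by simp

lemma tensor_basis_vec: "tensor_vec (basis_vec a) (basis_vec b) = basis_vec (a, b)"
  by (auto simp: tensor_vec_def basis_vec_def fun_eq_iff)

text \<open>Bilinearity of the product, which reduces identities in the algebra to basis vectors.\<close>

lemma alg_monoid_mult_sum_right:
  "f \<otimes>\<^bsub>alg_monoid A\<^esub> (\<lambda>x. \<Sum>i\<in>I. c i * g i x) = (\<lambda>x. \<Sum>i\<in>I. c i * (f \<otimes>\<^bsub>alg_monoid A\<^esub> g i) x)"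
proof -
  have "(\<Sum>a\<in>basis A. \<Sum>b\<in>basis A. f a * (\<Sum>i\<in>I. c i * g i b) * m a b) =
    (\<Sum>i\<in>I. c i * (\<Sum>a\<in>basis A. \<Sum>b\<in>basis A. f a * g i b * m a b))" for m :: "'a \<Rightarrow> 'a \<Rightarrow> complex"
    by (simp add: sum_distrib_left sum_distrib_right sum.swap [of _ I] mult_ac)
  thus ?thesis by (simp add: alg_monoid_def)
qed

lemma alg_monoid_mult_sum_left:
  "(\<lambda>x. \<Sum>i\<in>I. c i * g i x) \<otimes>\<^bsub>alg_monoid A\<^esub> f = (\<lambda>x. \<Sum>i\<in>I. c i * (g i \<otimes>\<^bsub>alg_monoid A\<^esub> f) x)"
proof -
  have "(\<Sum>a\<in>basis A. \<Sum>b\<in>basis A. (\<Sum>i\<in>I. c i * g i a) * f b * m a b) =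
    (\<Sum>i\<in>I. c i * (\<Sum>a\<in>basis A. \<Sum>b\<in>basis A. g i a * f b * m a b))" for m :: "'a \<Rightarrow> 'a \<Rightarrow> complex"
    by (simp add: sum_distrib_left sum_distrib_right sum.swap [of _ I] mult_ac)
  thus ?thesis by (simp add: alg_monoid_def)
qed

text \<open>The next four identities expand products of the shape that arises when an element of the second
  tensor power is placed into two legs of the third one and multiplied by the unit in the remaining
  leg. They differ only in the order in which the three legs are summed.\<close>

lemma sum2_times_sum:
  fixes f :: "'b \<Rightarrow> 'b \<Rightarrow> complex"
  shows "(\<Sum>a\<in>P. \<Sum>b\<in>P. f a b) * (\<Sum>c\<in>P. g c) = (\<Sum>a\<in>P. \<Sum>b\<in>P. \<Sum>c\<in>P. f a b * g c)"
  unfolding sum_distrib_right by (simp only: sum_distrib_left)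

lemma sum2_times_sum_middle:
  fixes f :: "'b \<Rightarrow> 'b \<Rightarrow> complex"
  shows "(\<Sum>a\<in>P. \<Sum>c\<in>P. f a c) * (\<Sum>b\<in>P. g b) = (\<Sum>a\<in>P. \<Sum>b\<in>P. \<Sum>c\<in>P. f a c * g b)"
  unfolding sum2_times_sum by (intro sum.cong refl sum.swap)

lemma sum2_times_sum_reverse:
  fixes f :: "'b \<Rightarrow> 'b \<Rightarrow> complex"
  shows "(\<Sum>c\<in>P. \<Sum>a\<in>P. f c a) * (\<Sum>b\<in>P. g b) = (\<Sum>a\<in>P. \<Sum>b\<in>P. \<Sum>c\<in>P. f c a * g b)"
  by (subst sum.swap [of f]) (rule sum2_times_sum_middle)

lemma sum_times_sum2:
  fixes f :: "'b \<Rightarrow> 'b \<Rightarrow> complex"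
  shows "(\<Sum>a\<in>P. g a) * (\<Sum>b\<in>P. \<Sum>c\<in>P. f b c) = (\<Sum>a\<in>P. \<Sum>b\<in>P. \<Sum>c\<in>P. g a * f b c)"
  unfolding sum_distrib_right by (simp only: sum_distrib_left)

text \<open>Here \<open>arr p k\<close> is the arrow with label \<open>k\<close> starting at \<open>p\<close>. The set \<open>D\<close> of starting points may be
  a proper subset of the objects: the coproducts of basis vectors have this form.\<close>

definition section_vec :: "('o \<Rightarrow> 'k \<Rightarrow> 'b) \<Rightarrow> 'o set \<Rightarrow> ('o \<Rightarrow> 'k) \<Rightarrow> 'b \<Rightarrow> complex" where
  "section_vec arr D \<sigma> = (\<lambda>z. \<Sum>p\<in>D. basis_vec (arr p (\<sigma> p)) z)"

definition section_mult ::
    "('k, 'n) monoid_scheme \<Rightarrow> ('o \<Rightarrow> 'k \<Rightarrow> 'o) \<Rightarrow> ('o \<Rightarrow> 'k) \<Rightarrow> ('o \<Rightarrow> 'k) \<Rightarrow> 'o \<Rightarrow> 'k" where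
  "section_mult K act \<sigma> \<tau> = (\<lambda>p. \<sigma> p \<otimes>\<^bsub>K\<^esub> \<tau> (act p (\<sigma> p)))"

text \<open>The algebra \<open>A\<close> of the groupoid of the right action \<open>act\<close> of the group \<open>K\<close> on the set \<open>X\<close> of objects.
  The basis of \<open>A\<close> is kept abstract and only parametrized by \<open>arr\<close>, because in the application it
  consists of group elements, and of pairs and triples of them.\<close>

locale action_algebra = K: group K
  for A :: "('b, 'm) based_algebra_scheme" and K :: "('k, 'n) monoid_scheme" (structure)
    and X :: "'o set" and act :: "'o \<Rightarrow> 'k \<Rightarrow> 'o" and arr :: "'o \<Rightarrow> 'k \<Rightarrow> 'b" +
  assumes finite_objects: "finite X" and finite_labels: "finite (carrier K)"
    and act_closed [simp]: "p \<in> X \<Longrightarrow> k \<in> carrier K \<Longrightarrow> act p k \<in> X"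
    and act_one: "p \<in> X \<Longrightarrow> act p \<one> = p"
    and act_mult: "p \<in> X \<Longrightarrow> k \<in> carrier K \<Longrightarrow> l \<in> carrier K \<Longrightarrow> act p (k \<otimes> l) = act (act p k) l"
    and arr_inj: "p \<in> X \<Longrightarrow> k \<in> carrier K \<Longrightarrow> q \<in> X \<Longrightarrow> l \<in> carrier K \<Longrightarrow>
      arr p k = arr q l \<longleftrightarrow> p = q \<and> k = l"
    and basis_eq: "basis A = (\<lambda>(p, k). arr p k) ` (X \<times> carrier K)"
    and basis_mult_arr: "p \<in> X \<Longrightarrow> k \<in> carrier K \<Longrightarrow> q \<in> X \<Longrightarrow> l \<in> carrier K \<Longrightarrow>
      basis_mult A (arr p k) (arr q l) = (\<lambda>z. if act p k = q then basis_vec (arr p (k \<otimes> l)) z else 0)"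
    and alg_unit_eq: "alg_unit A = section_vec arr X (\<lambda>_. \<one>)"
begin

abbreviation vec :: "'o set \<Rightarrow> ('o \<Rightarrow> 'k) \<Rightarrow> 'b \<Rightarrow> complex" where
  "vec \<equiv> section_vec arr"

lemma one_eq_vec: "\<one>\<^bsub>alg_monoid A\<^esub> = vec X (\<lambda>_. \<one>)"
  by (simp add: alg_monoid_def alg_unit_eq)

lemma finite_basis: "finite (basis A)"
  using finite_objects finite_labels by (simp add: basis_eq)

lemma arr_basis [simp]: "p \<in> X \<Longrightarrow> k \<in> carrier K \<Longrightarrow> arr p k \<in> basis A"
  by (auto simp: basis_eq)

lemma section_vec_closed:
  assumes "D \<subseteq> X" "\<sigma> \<in> X \<rightarrow> carrier K"
  shows "vec D \<sigma> \<in> carrier (alg_monoid A)"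
proof -
  have "arr p (\<sigma> p) \<in> basis A" if "p \<in> D" for p using assms that by (auto simp: Pi_iff)
  thus ?thesis by (auto simp: alg_monoid_def section_vec_def basis_vec_def intro!: sum.neutral)
qed

text \<open>The arrow of the first factor starting at \<open>p\<close> composes with exactly one arrow of the second factor,
  the one starting at its end \<open>act p (\<sigma> p)\<close>, if that point lies in \<open>E\<close>.\<close>

lemma section_vec_mult:
  assumes D: "D \<subseteq> X" "E \<subseteq> X" and s: "\<sigma> \<in> X \<rightarrow> carrier K" "\<tau> \<in> X \<rightarrow> carrier K"
  shows "vec D \<sigma> \<otimes>\<^bsub>alg_monoid A\<^esub> vec E \<tau> = vec {p \<in> D. act p (\<sigma> p) \<in> E} (section_mult K act \<sigma> \<tau>)"
proof
  fix z
  have fin: "finite D" "finite E" using D finite_objects finite_subset by auto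
  have "(vec D \<sigma> \<otimes>\<^bsub>alg_monoid A\<^esub> vec E \<tau>) z =
      (\<Sum>a\<in>basis A. vec D \<sigma> a * (\<Sum>b\<in>basis A. vec E \<tau> b * basis_mult A a b z))"
    by (simp add: alg_monoid_def sum_distrib_left mult_ac)
  also have "\<dots> = (\<Sum>p\<in>D. \<Sum>b\<in>basis A. vec E \<tau> b * basis_mult A (arr p (\<sigma> p)) b z)"
    unfolding section_vec_def [of arr D] using D s
    by (intro sum_basis_vec_mult finite_basis fin) (auto simp: Pi_iff)
  also have "\<dots> = (\<Sum>p\<in>D. \<Sum>q\<in>E. basis_mult A (arr p (\<sigma> p)) (arr q (\<tau> q)) z)"
    unfolding section_vec_def using D s
    by (intro sum.cong refl sum_basis_vec_mult finite_basis fin) (auto simp: Pi_iff)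
  also have "\<dots> = (\<Sum>p\<in>D. \<Sum>q\<in>E. if act p (\<sigma> p) = q then basis_vec (arr p (\<sigma> p \<otimes> \<tau> q)) z else 0)"
  proof (intro sum.cong refl)
    fix p q assume "p \<in> D" "q \<in> E"
    thus "basis_mult A (arr p (\<sigma> p)) (arr q (\<tau> q)) z =
      (if act p (\<sigma> p) = q then basis_vec (arr p (\<sigma> p \<otimes> \<tau> q)) z else 0)"
      using D s by (subst basis_mult_arr) (auto simp: Pi_iff)
  qed
  also have "\<dots> = (\<Sum>p\<in>D. if act p (\<sigma> p) \<in> E then basis_vec (arr p (section_mult K act \<sigma> \<tau> p)) z else 0)"
    using fin by (simp add: section_mult_def cong: if_cong)
  also have "\<dots> = vec {p \<in> D. act p (\<sigma> p) \<in> E} (section_mult K act \<sigma> \<tau>) z"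
    using fin by (simp add: section_vec_def sum.inter_filter)
  finally show "(vec D \<sigma> \<otimes>\<^bsub>alg_monoid A\<^esub> vec E \<tau>) z = vec {p \<in> D. act p (\<sigma> p) \<in> E} (section_mult K act \<sigma> \<tau>) z" .
qed

lemma section_mult_closed:
  "\<sigma> \<in> X \<rightarrow> carrier K \<Longrightarrow> \<tau> \<in> X \<rightarrow> carrier K \<Longrightarrow> section_mult K act \<sigma> \<tau> \<in> X \<rightarrow> carrier K"
  by (auto simp: section_mult_def Pi_iff)

lemma global_section_vec_mult:
  assumes "\<sigma> \<in> X \<rightarrow> carrier K" "\<tau> \<in> X \<rightarrow> carrier K"
  shows "vec X \<sigma> \<otimes>\<^bsub>alg_monoid A\<^esub> vec X \<tau> = vec X (section_mult K act \<sigma> \<tau>)"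
proof -
  have "{p \<in> X. act p (\<sigma> p) \<in> X} = X" using assms by (auto simp: Pi_iff)
  thus ?thesis using section_vec_mult [of X X \<sigma> \<tau>] assms by simp
qed

lemma global_section_vec_mult3:
  assumes "\<sigma> \<in> X \<rightarrow> carrier K" "\<tau> \<in> X \<rightarrow> carrier K" "\<rho> \<in> X \<rightarrow> carrier K"
  shows "vec X \<sigma> \<otimes>\<^bsub>alg_monoid A\<^esub> vec X \<tau> \<otimes>\<^bsub>alg_monoid A\<^esub> vec X \<rho> =
    vec X (section_mult K act (section_mult K act \<sigma> \<tau>) \<rho>)"
  using assms by (simp only: global_section_vec_mult section_mult_closed)

lemma section_vec_eq_iff:
  assumes "\<sigma> \<in> X \<rightarrow> carrier K" "\<tau> \<in> X \<rightarrow> carrier K"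
  shows "vec X \<sigma> = vec X \<tau> \<longleftrightarrow> (\<forall>p\<in>X. \<sigma> p = \<tau> p)"
proof
  assume eq: "vec X \<sigma> = vec X \<tau>"
  have coeff: "vec X \<rho> (arr p k) = (if \<rho> p = k then 1 else 0)"
    if "\<rho> \<in> X \<rightarrow> carrier K" "p \<in> X" "k \<in> carrier K" for \<rho> p k
  proof -
    have "vec X \<rho> (arr p k) = (\<Sum>q\<in>X. if p = q then (if \<rho> p = k then 1 else 0) else 0)"
      unfolding section_vec_def using that
      by (intro sum.cong refl) (auto simp: basis_vec_def arr_inj Pi_iff)
    also have "\<dots> = (if \<rho> p = k then 1 else 0)" using that finite_objects by simp
    finally show ?thesis .
  qed
  show "\<forall>p\<in>X. \<sigma> p = \<tau> p"
  proof
    fix p assume p: "p \<in> X"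
    hence "vec X \<tau> (arr p (\<sigma> p)) = 1"
      using assms coeff [of \<sigma> p "\<sigma> p"] by (auto simp: Pi_iff simp flip: eq)
    thus "\<sigma> p = \<tau> p" using coeff [of \<tau> p "\<sigma> p"] assms p by (auto simp: Pi_iff split: if_splits)
  qed
next
  assume "\<forall>p\<in>X. \<sigma> p = \<tau> p"
  thus "vec X \<sigma> = vec X \<tau>" by (auto simp: section_vec_def intro!: ext sum.cong)
qed

lemma carrier_expand:
  assumes "f \<in> carrier (alg_monoid A)"
  shows "f = (\<lambda>x. \<Sum>a\<in>basis A. f a * basis_vec a x)"
proof
  fix x
  have "(\<Sum>a\<in>basis A. f a * basis_vec a x) = (\<Sum>a\<in>basis A. if x = a then f a else 0)"
    by (intro sum.cong) (auto simp: basis_vec_def)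
  also have "\<dots> = f x" using assms finite_basis by (auto simp: alg_monoid_def)
  finally show "f x = (\<Sum>a\<in>basis A. f a * basis_vec a x)" by simp
qed

lemma basis_vec_eq_section_vec: "basis_vec (arr p k) = vec {p} (\<lambda>_. k)"
  by (simp add: section_vec_def)

lemma section_vec_cong:
  assumes "D = E" "\<And>p. p \<in> E \<Longrightarrow> \<sigma> p = \<tau> p"
  shows "vec D \<sigma> = vec E \<tau>"
  using assms by (auto simp: section_vec_def intro!: ext sum.cong)

lemma constant_section_vec_mult:
  assumes "D \<subseteq> X" "E \<subseteq> X" "k \<in> carrier K" "l \<in> carrier K"
  shows "vec D (\<lambda>_. k) \<otimes>\<^bsub>alg_monoid A\<^esub> vec E (\<lambda>_. l) = vec {p \<in> D. act p k \<in> E} (\<lambda>_. k \<otimes> l)"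
  using assms by (simp add: section_vec_mult section_mult_def)

text \<open>Basis vectors are sections over one point, so associativity is the law
  \<open>act p (k \<otimes> l) = act (act p k) l\<close> for the domains together with associativity of labels.\<close>

lemma basis_mult_assoc:
  assumes "a \<in> basis A" "b \<in> basis A" "d \<in> basis A"
  shows "basis_vec a \<otimes>\<^bsub>alg_monoid A\<^esub> basis_vec b \<otimes>\<^bsub>alg_monoid A\<^esub> basis_vec d =
    basis_vec a \<otimes>\<^bsub>alg_monoid A\<^esub> (basis_vec b \<otimes>\<^bsub>alg_monoid A\<^esub> basis_vec d)"
proof -
  obtain p k q l r m where *: "a = arr p k" "b = arr q l" "d = arr r m"
      "p \<in> X" "q \<in> X" "r \<in> X" "k \<in> carrier K" "l \<in> carrier K" "m \<in> carrier K"
    using assms by (auto simp: basis_eq)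
  have "{x \<in> {p}. act x k \<in> {q}} \<subseteq> X" "{x \<in> {q}. act x l \<in> {r}} \<subseteq> X" using * by auto
  moreover have "{x \<in> {x \<in> {p}. act x k \<in> {q}}. act x (k \<otimes> l) \<in> {r}} =
      {x \<in> {p}. act x k \<in> {x \<in> {q}. act x l \<in> {r}}}"
    using * by (auto simp: act_mult)
  ultimately show ?thesis
    using *(4-) unfolding *(1-3) basis_vec_eq_section_vec by (simp add: constant_section_vec_mult K.m_assoc)
qed

lemma unit_mult_basis_vec:
  assumes "a \<in> basis A"
  shows "vec X (\<lambda>_. \<one>) \<otimes>\<^bsub>alg_monoid A\<^esub> basis_vec a = basis_vec a"
    and "basis_vec a \<otimes>\<^bsub>alg_monoid A\<^esub> vec X (\<lambda>_. \<one>) = basis_vec a"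
  using assms
  by (auto simp: basis_eq basis_vec_eq_section_vec section_vec_mult section_mult_def act_one
      intro!: section_vec_cong)

lemma monoid_alg_monoid: "monoid (alg_monoid A)"
proof
  let ?M = "alg_monoid A"
  have unit: "\<one>\<^bsub>?M\<^esub> = vec X (\<lambda>_. \<one>)" by (simp add: alg_monoid_def alg_unit_eq)
  show "\<one>\<^bsub>?M\<^esub> \<in> carrier ?M"
    unfolding unit by (rule section_vec_closed) auto
  show "f \<otimes>\<^bsub>?M\<^esub> g \<in> carrier ?M" if "f \<in> carrier ?M" "g \<in> carrier ?M" for f g
  proof -
    have "basis_mult A a b x = 0" if ab: "a \<in> basis A" "b \<in> basis A" "x \<notin> basis A" for a b x
    proof -
      obtain p k q l where *: "a = arr p k" "b = arr q l" "p \<in> X" "q \<in> X" "k \<in> carrier K" "l \<in> carrier K"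
        using ab by (auto simp: basis_eq)
      moreover from this have "x \<noteq> arr p (k \<otimes> l)" using ab arr_basis [of p "k \<otimes> l"] by auto
      ultimately show ?thesis by (simp add: basis_mult_arr basis_vec_def)
    qed
    thus ?thesis by (auto simp: alg_monoid_def intro!: sum.neutral)
  qed
  have expand_left: "f \<otimes>\<^bsub>?M\<^esub> g = (\<lambda>x. \<Sum>a\<in>basis A. f a * (basis_vec a \<otimes>\<^bsub>?M\<^esub> g) x)"
    if "f \<in> carrier ?M" for f g
    by (subst carrier_expand [OF that]) (rule alg_monoid_mult_sum_left)
  have expand_right: "g \<otimes>\<^bsub>?M\<^esub> f = (\<lambda>x. \<Sum>a\<in>basis A. f a * (g \<otimes>\<^bsub>?M\<^esub> basis_vec a) x)"
    if "f \<in> carrier ?M" for f g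
    by (subst carrier_expand [OF that]) (rule alg_monoid_mult_sum_right)
  show "f \<otimes>\<^bsub>?M\<^esub> g \<otimes>\<^bsub>?M\<^esub> h = f \<otimes>\<^bsub>?M\<^esub> (g \<otimes>\<^bsub>?M\<^esub> h)"
    if fgh: "f \<in> carrier ?M" "g \<in> carrier ?M" "h \<in> carrier ?M" for f g h
  proof -
    have 1: "basis_vec a \<otimes>\<^bsub>?M\<^esub> basis_vec b \<otimes>\<^bsub>?M\<^esub> h = basis_vec a \<otimes>\<^bsub>?M\<^esub> (basis_vec b \<otimes>\<^bsub>?M\<^esub> h)"
      if "a \<in> basis A" "b \<in> basis A" for a b
      unfolding expand_right [OF fgh(3)] alg_monoid_mult_sum_right
      using that by (simp add: basis_mult_assoc cong: sum.cong)
    have 2: "basis_vec a \<otimes>\<^bsub>?M\<^esub> g \<otimes>\<^bsub>?M\<^esub> h = basis_vec a \<otimes>\<^bsub>?M\<^esub> (g \<otimes>\<^bsub>?M\<^esub> h)"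
      if "a \<in> basis A" for a
      unfolding expand_right [OF fgh(2)] expand_left [OF fgh(2)] alg_monoid_mult_sum_right
        alg_monoid_mult_sum_left
      using that by (simp add: 1 cong: sum.cong)
    show ?thesis
      unfolding expand_left [OF fgh(1)] alg_monoid_mult_sum_left by (simp add: 2 cong: sum.cong)
  qed
  show "\<one>\<^bsub>?M\<^esub> \<otimes>\<^bsub>?M\<^esub> f = f" if f: "f \<in> carrier ?M" for f
    unfolding expand_right [OF f] unit
    by (simp add: unit_mult_basis_vec carrier_expand [OF f, symmetric] cong: sum.cong)
  show "f \<otimes>\<^bsub>?M\<^esub> \<one>\<^bsub>?M\<^esub> = f" if f: "f \<in> carrier ?M" for f
    unfolding expand_left [OF f] unit
    by (simp add: unit_mult_basis_vec carrier_expand [OF f, symmetric] cong: sum.cong)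
qed

end

lemma action_algebra_tensor:
  assumes "action_algebra A K X act arr" "action_algebra B L Y act' arr'"
  shows "action_algebra (tensor_alg A B) (K \<times>\<times> L) (X \<times> Y)
    (\<lambda>(p, q) (k, l). (act p k, act' q l)) (\<lambda>(p, q) (k, l). (arr p k, arr' q l))"
proof -
  interpret A: action_algebra A K X act arr by fact
  interpret B: action_algebra B L Y act' arr' by fact
  interpret KL: group "K \<times>\<times> L" by (rule DirProd_group [OF A.K.group_axioms B.K.group_axioms])
  show ?thesis
  proof (unfold_locales, goal_cases)
    \<comment> \<open>Goals 7 to 9 are the basis, the multiplication and the unit; the others concern the product action.\<close>
    case 7 thus ?case by (force simp: tensor_alg_def A.basis_eq B.basis_eq)
  next
    case 8 thus ?case
      by (auto simp: tensor_alg_def A.basis_mult_arr B.basis_mult_arr tensor_vec_def basis_vec_def fun_eq_iff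
          A.arr_inj B.arr_inj split: if_splits)
  next
    case 9 thus ?case
      by (auto simp: tensor_alg_def A.alg_unit_eq B.alg_unit_eq section_vec_def tensor_vec_def basis_vec_def
        sum_product sum.cartesian_product fun_eq_iff intro!: sum.cong)
  qed (auto simp: A.finite_objects B.finite_objects A.finite_labels B.finite_labels A.act_one B.act_one
      A.act_mult B.act_mult A.arr_inj B.arr_inj)
qed

section \<open>The factorization Hopf algebra and the braiding\<close>

context unique_factorization
begin

abbreviation "Gminus_group \<equiv> G\<lparr>carrier := Gminus G\<rparr>"

lemma action_algebra_factorization_hopf:
  assumes "finite (carrier G)"
  shows "action_algebra (factorization_hopf G) Gminus_group (Gplus G) (\<lambda>u x. u \<leftharpoonup> x) (\<lambda>u x. u \<otimes> x)"
proof -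
  interpret K: group Gminus_group by (rule subgroup_imp_group [OF subgroup_Gminus])
  show ?thesis
  proof (unfold_locales, goal_cases)
    \<comment> \<open>Goals 1 and 2 are finiteness, goals 7 to 9 the basis, the multiplication and the unit.\<close>
    case 1 show ?case using assms by (rule finite_subset [rotated]) auto
  next
    case 2 show ?case using assms by (simp, elim finite_subset [rotated]) auto
  next
    case 7 show ?case
      by (auto simp: factorization_hopf_def image_iff elim: factorization)
  next
    case 8 thus ?case by (auto simp: factorization_hopf_def m_assoc)
  next
    case 9 thus ?case
      by (auto simp: factorization_hopf_def section_vec_def intro!: ext sum.cong)
  qed (auto simp: minus_act_right_mult dest: factorization_eqD)
qed

end

locale braided_factorization = unique_factorization +
  fixes \<xi> \<eta> :: "'a \<Rightarrow> 'a"
  assumes finite_carrier: "finite (carrier G)"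
    and xi_hom: "\<xi> \<in> hom (G\<lparr>carrier := Gplus G\<rparr>) (G\<lparr>carrier := Gminus G\<rparr>)"
    and eta_hom: "\<eta> \<in> hom (G\<lparr>carrier := Gplus G\<rparr>) (G\<lparr>carrier := Gminus G\<rparr>)"
    and xi_act: "\<And>u v. u \<in> Gplus G \<Longrightarrow> v \<in> Gplus G \<Longrightarrow> \<xi> u \<triangleleft> v = \<xi> (u \<leftharpoonup> \<eta> v)"
    and eta_act: "\<And>u v. u \<in> Gplus G \<Longrightarrow> v \<in> Gplus G \<Longrightarrow> u \<rightharpoonup> \<eta> v = \<eta> (\<xi> u \<triangleright> v)"
    and braided_mult: "\<And>u v. u \<in> Gplus G \<Longrightarrow> v \<in> Gplus G \<Longrightarrow> u \<otimes> v = (\<xi> u \<triangleright> v) \<otimes> (u \<leftharpoonup> \<eta> v)"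
    and xi_crossed: "\<And>u x. u \<in> Gplus G \<Longrightarrow> x \<in> Gminus G \<Longrightarrow> \<xi> (x \<triangleright> u) \<otimes> (x \<triangleleft> u) = x \<otimes> \<xi> u"
    and eta_crossed: "\<And>u x. u \<in> Gplus G \<Longrightarrow> x \<in> Gminus G \<Longrightarrow> \<eta> (x \<triangleright> u) \<otimes> (x \<triangleleft> u) = x \<otimes> \<eta> u"
begin

lemma xi_closed [simp]: "u \<in> Gplus G \<Longrightarrow> \<xi> u \<in> Gminus G"
  using xi_hom by (auto simp: hom_def)

lemma eta_closed [simp]: "u \<in> Gplus G \<Longrightarrow> \<eta> u \<in> Gminus G"
  using eta_hom by (auto simp: hom_def)

lemma xi_mult: "u \<in> Gplus G \<Longrightarrow> v \<in> Gplus G \<Longrightarrow> \<xi> (u \<otimes> v) = \<xi> u \<otimes> \<xi> v"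
  using xi_hom by (auto simp: hom_def)

lemma eta_mult: "u \<in> Gplus G \<Longrightarrow> v \<in> Gplus G \<Longrightarrow> \<eta> (u \<otimes> v) = \<eta> u \<otimes> \<eta> v"
  using eta_hom by (auto simp: hom_def)

lemma finite_Gplus: "finite (Gplus G)"
  using finite_carrier by (rule finite_subset [rotated]) auto

text \<open>Rewriting \<open>u \<otimes> \<eta> v\<close> with \<open>eta_act\<close> gives \<open>\<eta> q \<otimes> p\<close>, and rewriting \<open>\<xi> u \<otimes> v\<close> with \<open>xi_act\<close> gives
  \<open>q \<otimes> \<xi> p\<close>. So both products are factorized in the two orders, and the actions can be read off.\<close>

lemma braiding_left_inverse:
  assumes "u \<in> Gplus G" "v \<in> Gplus G"
  defines "q \<equiv> \<xi> u \<triangleright> v" and "p \<equiv> u \<leftharpoonup> \<eta> v"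
  shows "\<eta> q \<triangleright> p = u" "\<eta> q \<triangleleft> p = \<eta> v" "q \<rightharpoonup> \<xi> p = \<xi> u" "q \<leftharpoonup> \<xi> p = v"
proof -
  have [simp]: "q \<in> Gplus G" "p \<in> Gplus G" using assms by auto
  have "\<eta> q \<otimes> p = u \<otimes> \<eta> v"
    using harpoon_mult [of u "\<eta> v"] eta_act [of u v] assms by simp
  thus "\<eta> q \<triangleright> p = u" "\<eta> q \<triangleleft> p = \<eta> v" using triangle_eqI [of "\<eta> q" p u "\<eta> v"] assms by auto
  have "q \<otimes> \<xi> p = \<xi> u \<otimes> v"
    using triangle_mult [of "\<xi> u" v] xi_act [of u v] assms by simp
  thus "q \<rightharpoonup> \<xi> p = \<xi> u" "q \<leftharpoonup> \<xi> p = v" using harpoon_eqI [of q "\<xi> p" "\<xi> u" v] assms by auto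
qed

lemma braiding_surj:
  assumes "q \<in> Gplus G" "p \<in> Gplus G"
  obtains u v where "u \<in> Gplus G" "v \<in> Gplus G" "q = \<xi> u \<triangleright> v" "p = u \<leftharpoonup> \<eta> v"
proof -
  let ?s = "\<lambda>(u, v). (\<xi> u \<triangleright> v, u \<leftharpoonup> \<eta> v)" and ?X = "Gplus G \<times> Gplus G"
  have "inj_on ?s ?X"
    by (rule inj_on_inverseI [where g = "\<lambda>(q, p). (\<eta> q \<triangleright> p, q \<leftharpoonup> \<xi> p)"])
      (auto simp: braiding_left_inverse)
  moreover have "?s ` ?X \<subseteq> ?X" by auto
  ultimately have "?s ` ?X = ?X" using finite_Gplus by (intro endo_inj_surj) auto
  hence "(q, p) \<in> ?s ` ?X" using assms by simp
  thus thesis using that by auto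
qed

text \<open>As the braiding is onto, every pair \<open>(q, p)\<close> is an image of it, and the conditions on the
  braiding turn into identities for the inverse map.\<close>

lemma braiding_inverse:
  assumes "q \<in> Gplus G" "p \<in> Gplus G"
  shows xi_braiding_inverse: "\<xi> (\<eta> q \<triangleright> p) = q \<rightharpoonup> \<xi> p"
    and eta_braiding_inverse: "\<eta> (q \<leftharpoonup> \<xi> p) = \<eta> q \<triangleleft> p"
    and braiding_inverse_mult: "(\<eta> q \<triangleright> p) \<otimes> (q \<leftharpoonup> \<xi> p) = q \<otimes> p"
    and braiding_right_inverse: "\<xi> (\<eta> q \<triangleright> p) \<triangleright> (q \<leftharpoonup> \<xi> p) = q" "(\<eta> q \<triangleright> p) \<leftharpoonup> \<eta> (q \<leftharpoonup> \<xi> p) = p"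
proof -
  obtain u v where uv: "u \<in> Gplus G" "v \<in> Gplus G" "q = \<xi> u \<triangleright> v" "p = u \<leftharpoonup> \<eta> v"
    using braiding_surj assms by blast
  note inv = braiding_left_inverse [OF uv(1,2), folded uv(3,4)]
  show "\<xi> (\<eta> q \<triangleright> p) = q \<rightharpoonup> \<xi> p" "\<eta> (q \<leftharpoonup> \<xi> p) = \<eta> q \<triangleleft> p" "(\<eta> q \<triangleright> p) \<otimes> (q \<leftharpoonup> \<xi> p) = q \<otimes> p"
    "\<xi> (\<eta> q \<triangleright> p) \<triangleright> (q \<leftharpoonup> \<xi> p) = q" "(\<eta> q \<triangleright> p) \<leftharpoonup> \<eta> (q \<leftharpoonup> \<xi> p) = p"
    using braided_mult [OF uv(1,2), folded uv(3,4)] inv uv by simp_all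
qed

lemma eta_xi_commute:
  assumes "q \<in> Gplus G" "p \<in> Gplus G"
  shows "\<xi> (\<eta> q \<triangleright> p) \<otimes> \<eta> (q \<leftharpoonup> \<xi> p) = \<eta> q \<otimes> \<xi> p"
  using assms by (simp add: eta_braiding_inverse xi_crossed)

text \<open>The first label of \<open>R\<close> at \<open>(p, q)\<close> is \<open>inv (\<eta> q \<triangleleft> p) = inv (\<eta> (q \<leftharpoonup> \<xi> p))\<close>. Since \<open>\<eta> q \<otimes> p = (\<eta> q \<triangleright> p) \<otimes> (\<eta> q \<triangleleft> p)\<close>, this label moves \<open>p\<close> to
  \<open>\<eta> q \<triangleright> p\<close>.\<close>

lemma R_first_leg:
  assumes "q \<in> Gplus G" "p \<in> Gplus G"
  shows "p \<leftharpoonup> inv (\<eta> (q \<leftharpoonup> \<xi> p)) = \<eta> q \<triangleright> p" "p \<rightharpoonup> inv (\<eta> (q \<leftharpoonup> \<xi> p)) = inv (\<eta> q)"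
proof -
  have "p \<otimes> inv (\<eta> q \<triangleleft> p) = inv (\<eta> q) \<otimes> (\<eta> q \<triangleright> p)"
  proof -
    have "\<eta> q \<otimes> (p \<otimes> inv (\<eta> q \<triangleleft> p)) = (\<eta> q \<otimes> p) \<otimes> inv (\<eta> q \<triangleleft> p)"
      using assms by (simp add: m_assoc)
    also have "\<dots> = \<eta> q \<triangleright> p"
      using assms by (simp add: m_assoc flip: triangle_mult)
    finally show ?thesis using assms by (metis Gminus_closed Gminus_inv Gplus_closed inv_solve_left' 
      eta_closed m_closed triangle_minus)
  qed
  thus "p \<leftharpoonup> inv (\<eta> (q \<leftharpoonup> \<xi> p)) = \<eta> q \<triangleright> p" "p \<rightharpoonup> inv (\<eta> (q \<leftharpoonup> \<xi> p)) = inv (\<eta> q)"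
    unfolding eta_braiding_inverse [OF assms]
    using harpoon_eqI [of p "inv (\<eta> q \<triangleleft> p)" "inv (\<eta> q)" "\<eta> q \<triangleright> p"] assms by auto
qed

text \<open>The crossed homomorphism conditions for the other pair of actions, obtained by applying them to
  the inverse \<open>inv y\<close> of \<open>y = p \<rightharpoonup> x\<close>, which takes \<open>p\<close> to \<open>p \<leftharpoonup> x\<close>.\<close>

lemma xi_eta_harpoon:
  assumes "p \<in> Gplus G" "x \<in> Gminus G"
  shows xi_harpoon: "(p \<rightharpoonup> x) \<otimes> \<xi> (p \<leftharpoonup> x) = \<xi> p \<otimes> x"
    and eta_harpoon: "(p \<rightharpoonup> x) \<otimes> \<eta> (p \<leftharpoonup> x) = \<eta> p \<otimes> x"
proof -
  define y w where "y = p \<rightharpoonup> x" and "w = p \<leftharpoonup> x"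
  have [simp]: "y \<in> Gminus G" "w \<in> Gplus G" using assms by (auto simp: y_def w_def)
  have yw: "p \<otimes> x = y \<otimes> w" using harpoon_mult [of p x] assms by (simp add: y_def w_def)
  have "inv y \<otimes> p = w \<otimes> inv x"
  proof -
    have "inv y \<otimes> p = inv y \<otimes> (p \<otimes> x) \<otimes> inv x" using assms by (simp add: m_assoc)
    also have "\<dots> = w \<otimes> inv x" using assms by (simp add: yw m_assoc [symmetric])
    finally show ?thesis .
  qed
  hence "inv y \<triangleright> p = w" "inv y \<triangleleft> p = inv x" using triangle_eqI [of "inv y" p w "inv x"] assms by auto
  hence eqs: "\<xi> w \<otimes> inv x = inv y \<otimes> \<xi> p" "\<eta> w \<otimes> inv x = inv y \<otimes> \<eta> p"
    using xi_crossed [of p "inv y"] eta_crossed [of p "inv y"] assms by auto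
  have "y \<otimes> a = b \<otimes> x" if "a \<otimes> inv x = inv y \<otimes> b" "a \<in> Gminus G" "b \<in> Gminus G" for a b
  proof -
    have "y \<otimes> a = y \<otimes> (a \<otimes> inv x) \<otimes> x" using that(2) assms by (simp add: m_assoc)
    also have "\<dots> = b \<otimes> x" unfolding that(1) using that(2-) assms by (simp add: m_assoc [symmetric])
    finally show ?thesis .
  qed
  from this [OF eqs(1)] this [OF eqs(2)]
  show "(p \<rightharpoonup> x) \<otimes> \<xi> (p \<leftharpoonup> x) = \<xi> p \<otimes> x" "(p \<rightharpoonup> x) \<otimes> \<eta> (p \<leftharpoonup> x) = \<eta> p \<otimes> x"
    using assms by (auto simp: y_def w_def)
qed

lemma minus_act_right_inv:
  assumes "q \<in> Gplus G" "x \<in> Gminus G" "q \<leftharpoonup> x = b"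
  shows "b \<leftharpoonup> inv x = q"
  using assms by (auto simp flip: minus_act_right_mult)

section \<open>R and its leg placements as sections\<close>

abbreviation "H \<equiv> factorization_hopf G"

sublocale H1: action_algebra H Gminus_group "Gplus G" "\<lambda>u x. u \<leftharpoonup> x" "\<lambda>u x. u \<otimes> x"
  by (rule action_algebra_factorization_hopf [OF finite_carrier])

sublocale H2: action_algebra "tensor_alg H H" "Gminus_group \<times>\<times> Gminus_group" "Gplus G \<times> Gplus G"
    "\<lambda>(p, q) (k, l). (p \<leftharpoonup> k, q \<leftharpoonup> l)" "\<lambda>(p, q) (k, l). (p \<otimes> k, q \<otimes> l)"
  by (rule action_algebra_tensor [OF H1.action_algebra_axioms H1.action_algebra_axioms])

sublocale H3: action_algebra "tensor_alg H (tensor_alg H H)"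
    "Gminus_group \<times>\<times> (Gminus_group \<times>\<times> Gminus_group)" "Gplus G \<times> Gplus G \<times> Gplus G"
    "\<lambda>(p, qr) (k, lm). (p \<leftharpoonup> k, (\<lambda>(p, q) (k, l). (p \<leftharpoonup> k, q \<leftharpoonup> l)) qr lm)"
    "\<lambda>(p, qr) (k, lm). (p \<otimes> k, (\<lambda>(p, q) (k, l). (p \<otimes> k, q \<otimes> l)) qr lm)"
  by (rule action_algebra_tensor [OF H1.action_algebra_axioms H2.action_algebra_axioms])

abbreviation "X2 \<equiv> Gplus G \<times> Gplus G"
abbreviation "X3 \<equiv> Gplus G \<times> Gplus G \<times> Gplus G"

text \<open>The first label of \<open>R\<close> is \<open>inv (\<eta> q \<triangleleft> p)\<close>, written by \<open>eta_braiding_inverse\<close> in terms of the point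
  \<open>q \<leftharpoonup> \<xi> p\<close> to which the second leg moves; in this form labels of composites simplify.\<close>

definition R_label :: "'a \<times> 'a \<Rightarrow> 'a \<times> 'a" where
  "R_label = (\<lambda>(p, q). (inv (\<eta> (q \<leftharpoonup> \<xi> p)), \<xi> p))"

text \<open>The end point of \<open>R\<close> starting at \<open>(p, q)\<close> is \<open>(a, b)\<close> iff \<open>(q, p)\<close> is the image of \<open>(a, b)\<close> under the
  braiding. So \<open>p = a \<leftharpoonup> \<eta> b\<close>, and the labels of the inverse are explicit.\<close>

definition R_inv_label :: "'a \<times> 'a \<Rightarrow> 'a \<times> 'a" where
  "R_inv_label = (\<lambda>(p, q). (\<eta> q, inv (\<xi> (p \<leftharpoonup> \<eta> q))))"

lemma R_elem_eq: "R_elem G \<xi> \<eta> = H2.vec X2 R_label"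
  by (auto simp: R_elem_def section_vec_def R_label_def tensor_basis_vec eta_braiding_inverse
      sum.cartesian_product intro!: ext sum.cong)

lemma R_label_closed: "R_label \<in> X2 \<rightarrow> carrier (Gminus_group \<times>\<times> Gminus_group)"
  by (auto simp: R_label_def)

lemma R_inv_label_closed: "R_inv_label \<in> X2 \<rightarrow> carrier (Gminus_group \<times>\<times> Gminus_group)"
  by (auto simp: R_inv_label_def)

text \<open>At \<open>(a, b)\<close> the inverse ends in \<open>(a \<leftharpoonup> \<eta> b, \<xi> a \<triangleright> b)\<close>, the braiding of \<open>(a, b)\<close> with the legs swapped.\<close>

lemma R_inv_target:
  assumes "a \<in> Gplus G" "b \<in> Gplus G"
  shows "b \<leftharpoonup> inv (\<xi> (a \<leftharpoonup> \<eta> b)) = \<xi> a \<triangleright> b"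
  using assms by (intro minus_act_right_inv) (auto simp: braiding_left_inverse)

text \<open>In \<open>label\<^sub>i\<^sub>j \<sigma>\<close> the first leg of \<open>\<sigma>\<close> is placed at position \<open>i\<close> and the second one at position \<open>j\<close>.\<close>

definition label12 :: "('a \<times> 'a \<Rightarrow> 'a \<times> 'a) \<Rightarrow> 'a \<times> 'a \<times> 'a \<Rightarrow> 'a \<times> 'a \<times> 'a" where
  "label12 \<sigma> = (\<lambda>(a, b, c). (fst (\<sigma> (a, b)), snd (\<sigma> (a, b)), \<one>))"
definition label13 :: "('a \<times> 'a \<Rightarrow> 'a \<times> 'a) \<Rightarrow> 'a \<times> 'a \<times> 'a \<Rightarrow> 'a \<times> 'a \<times> 'a" where
  "label13 \<sigma> = (\<lambda>(a, b, c). (fst (\<sigma> (a, c)), \<one>, snd (\<sigma> (a, c))))"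
definition label23 :: "('a \<times> 'a \<Rightarrow> 'a \<times> 'a) \<Rightarrow> 'a \<times> 'a \<times> 'a \<Rightarrow> 'a \<times> 'a \<times> 'a" where
  "label23 \<sigma> = (\<lambda>(a, b, c). (\<one>, fst (\<sigma> (b, c)), snd (\<sigma> (b, c))))"
definition label21 :: "('a \<times> 'a \<Rightarrow> 'a \<times> 'a) \<Rightarrow> 'a \<times> 'a \<times> 'a \<Rightarrow> 'a \<times> 'a \<times> 'a" where
  "label21 \<sigma> = (\<lambda>(a, b, c). (snd (\<sigma> (b, a)), fst (\<sigma> (b, a)), \<one>))"
definition label31 :: "('a \<times> 'a \<Rightarrow> 'a \<times> 'a) \<Rightarrow> 'a \<times> 'a \<times> 'a \<Rightarrow> 'a \<times> 'a \<times> 'a" where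
  "label31 \<sigma> = (\<lambda>(a, b, c). (snd (\<sigma> (c, a)), \<one>, fst (\<sigma> (c, a))))"
definition label32 :: "('a \<times> 'a \<Rightarrow> 'a \<times> 'a) \<Rightarrow> 'a \<times> 'a \<times> 'a \<Rightarrow> 'a \<times> 'a \<times> 'a" where
  "label32 \<sigma> = (\<lambda>(a, b, c). (\<one>, snd (\<sigma> (c, b)), fst (\<sigma> (c, b))))"

lemmas label_defs = label12_def label13_def label23_def label21_def label31_def label32_def

lemma label_closed:
  assumes "\<sigma> \<in> X2 \<rightarrow> carrier (Gminus_group \<times>\<times> Gminus_group)"
  shows "label12 \<sigma> \<in> X3 \<rightarrow> carrier (Gminus_group \<times>\<times> Gminus_group \<times>\<times> Gminus_group)"
    "label13 \<sigma> \<in> X3 \<rightarrow> carrier (Gminus_group \<times>\<times> Gminus_group \<times>\<times> Gminus_group)"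
    "label23 \<sigma> \<in> X3 \<rightarrow> carrier (Gminus_group \<times>\<times> Gminus_group \<times>\<times> Gminus_group)"
    "label21 \<sigma> \<in> X3 \<rightarrow> carrier (Gminus_group \<times>\<times> Gminus_group \<times>\<times> Gminus_group)"
    "label31 \<sigma> \<in> X3 \<rightarrow> carrier (Gminus_group \<times>\<times> Gminus_group \<times>\<times> Gminus_group)"
    "label32 \<sigma> \<in> X3 \<rightarrow> carrier (Gminus_group \<times>\<times> Gminus_group \<times>\<times> Gminus_group)"
  using assms by (auto simp: label_defs Pi_iff mem_Times_iff)

lemma vec2_apply:
  "H2.vec X2 \<sigma> (x, y) = (\<Sum>a\<in>Gplus G. \<Sum>b\<in>Gplus G.
     basis_vec (a \<otimes> fst (\<sigma> (a, b))) x * basis_vec (b \<otimes> snd (\<sigma> (a, b))) y)"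
  by (auto simp: section_vec_def sum.cartesian_product split_def basis_vec_def intro!: sum.cong)

lemma vec3_apply:
  "H3.vec X3 \<sigma> (x, y, z) = (\<Sum>a\<in>Gplus G. \<Sum>b\<in>Gplus G. \<Sum>c\<in>Gplus G.
     basis_vec (a \<otimes> fst (\<sigma> (a, b, c))) x * basis_vec (b \<otimes> fst (snd (\<sigma> (a, b, c)))) y *
     basis_vec (c \<otimes> snd (snd (\<sigma> (a, b, c)))) z)"
  by (auto simp: section_vec_def sum.cartesian_product split_def basis_vec_def intro!: sum.cong)

lemma unit_apply: "alg_unit H x = (\<Sum>c\<in>Gplus G. basis_vec (c \<otimes> \<one>) x)"
  by (auto simp: H1.alg_unit_eq section_vec_def intro!: sum.cong)

lemma leg12_vec: "leg12 H (H2.vec X2 \<sigma>) = H3.vec X3 (label12 \<sigma>)"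
proof (rule ext, clarify)
  fix x y z
  show "leg12 H (H2.vec X2 \<sigma>) (x, y, z) = H3.vec X3 (label12 \<sigma>) (x, y, z)"
    unfolding leg12_def label12_def prod.case vec2_apply vec3_apply unit_apply fst_conv snd_conv sum2_times_sum
    by (simp only: mult_ac)
qed

lemma leg13_vec: "leg13 H (H2.vec X2 \<sigma>) = H3.vec X3 (label13 \<sigma>)"
proof (rule ext, clarify)
  fix x y z
  show "leg13 H (H2.vec X2 \<sigma>) (x, y, z) = H3.vec X3 (label13 \<sigma>) (x, y, z)"
    unfolding leg13_def label13_def prod.case vec2_apply vec3_apply unit_apply fst_conv snd_conv sum2_times_sum_middle
    by (simp only: mult_ac)
qed

lemma leg23_vec: "leg23 H (H2.vec X2 \<sigma>) = H3.vec X3 (label23 \<sigma>)"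
proof (rule ext, clarify)
  fix x y z
  show "leg23 H (H2.vec X2 \<sigma>) (x, y, z) = H3.vec X3 (label23 \<sigma>) (x, y, z)"
    unfolding leg23_def label23_def prod.case vec2_apply vec3_apply unit_apply fst_conv snd_conv sum_times_sum2
    by (simp only: mult_ac)
qed

lemma leg31_vec: "leg31 H (H2.vec X2 \<sigma>) = H3.vec X3 (label31 \<sigma>)"
proof (rule ext, clarify)
  fix x y z
  show "leg31 H (H2.vec X2 \<sigma>) (x, y, z) = H3.vec X3 (label31 \<sigma>) (x, y, z)"
    unfolding leg31_def label31_def prod.case vec2_apply vec3_apply unit_apply fst_conv snd_conv sum2_times_sum_reverse
    by (simp only: mult_ac)
qed

text \<open>The labels of \<open>R12 R13 R23\<close> and \<open>R23 R13 R12\<close> at the object \<open>(a, b, c)\<close>. In the first leg both sides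
  invert \<open>\<eta> ((c \<otimes> b) \<leftharpoonup> \<xi> a)\<close>, factorized along \<open>c \<otimes> b\<close> and along \<open>(\<eta> c \<triangleright> b) \<otimes> (c \<leftharpoonup> \<xi> b)\<close>. In the third leg
  both are \<open>\<xi> (b \<otimes> a)\<close>. The second leg is \<open>eta_xi_commute\<close>.\<close>

lemma label_yang_baxter:
  assumes "a \<in> Gplus G" "b \<in> Gplus G" "c \<in> Gplus G"
  shows label_yang_baxter_first: "inv (\<eta> (b \<leftharpoonup> \<xi> a)) \<otimes> inv (\<eta> (c \<leftharpoonup> \<xi> (\<eta> b \<triangleright> a))) =
      inv (\<eta> (c \<leftharpoonup> \<xi> b \<leftharpoonup> \<xi> a)) \<otimes> inv (\<eta> ((\<eta> c \<triangleright> b) \<leftharpoonup> \<xi> (\<eta> (c \<leftharpoonup> \<xi> b) \<triangleright> a)))"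
    and label_yang_baxter_second: "\<xi> a \<otimes> inv (\<eta> (c \<leftharpoonup> \<xi> (\<eta> b \<triangleright> a) \<leftharpoonup> \<xi> (b \<leftharpoonup> \<xi> a))) =
      inv (\<eta> (c \<leftharpoonup> \<xi> b)) \<otimes> \<xi> (\<eta> (c \<leftharpoonup> \<xi> b) \<triangleright> a)"
    and label_yang_baxter_third: "\<xi> (\<eta> b \<triangleright> a) \<otimes> \<xi> (b \<leftharpoonup> \<xi> a) = \<xi> b \<otimes> \<xi> a"
proof -
  show third: "\<xi> (\<eta> b \<triangleright> a) \<otimes> \<xi> (b \<leftharpoonup> \<xi> a) = \<xi> b \<otimes> \<xi> a"
    using assms by (simp add: braiding_inverse_mult flip: xi_mult)
  have "inv (\<eta> (b \<leftharpoonup> \<xi> a)) \<otimes> inv (\<eta> (c \<leftharpoonup> \<xi> (\<eta> b \<triangleright> a))) =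
      inv (\<eta> ((c \<leftharpoonup> \<xi> (\<eta> b \<triangleright> a)) \<otimes> (b \<leftharpoonup> \<xi> a)))"
    using assms by (simp add: eta_mult inv_mult_group)
  also have "(c \<leftharpoonup> \<xi> (\<eta> b \<triangleright> a)) \<otimes> (b \<leftharpoonup> \<xi> a) = (c \<otimes> b) \<leftharpoonup> \<xi> a"
    using assms by (simp add: xi_braiding_inverse mult_minus_act_right)
  also have "c \<otimes> b = (\<eta> c \<triangleright> b) \<otimes> (c \<leftharpoonup> \<xi> b)"
    using assms by (simp add: braiding_inverse_mult)
  also have "\<dots> \<leftharpoonup> \<xi> a = ((\<eta> c \<triangleright> b) \<leftharpoonup> \<xi> (\<eta> (c \<leftharpoonup> \<xi> b) \<triangleright> a)) \<otimes> (c \<leftharpoonup> \<xi> b \<leftharpoonup> \<xi> a)"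
    using assms by (simp add: xi_braiding_inverse mult_minus_act_right)
  also have "inv (\<eta> \<dots>) =
      inv (\<eta> (c \<leftharpoonup> \<xi> b \<leftharpoonup> \<xi> a)) \<otimes> inv (\<eta> ((\<eta> c \<triangleright> b) \<leftharpoonup> \<xi> (\<eta> (c \<leftharpoonup> \<xi> b) \<triangleright> a)))"
    using assms by (simp add: eta_mult inv_mult_group)
  finally show "inv (\<eta> (b \<leftharpoonup> \<xi> a)) \<otimes> inv (\<eta> (c \<leftharpoonup> \<xi> (\<eta> b \<triangleright> a))) =
      inv (\<eta> (c \<leftharpoonup> \<xi> b \<leftharpoonup> \<xi> a)) \<otimes> inv (\<eta> ((\<eta> c \<triangleright> b) \<leftharpoonup> \<xi> (\<eta> (c \<leftharpoonup> \<xi> b) \<triangleright> a)))" .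
  define d where "d = c \<leftharpoonup> \<xi> b"
  have d: "d \<in> Gplus G" using assms by (simp add: d_def)
  have "c \<leftharpoonup> \<xi> (\<eta> b \<triangleright> a) \<leftharpoonup> \<xi> (b \<leftharpoonup> \<xi> a) = d \<leftharpoonup> \<xi> a"
    using assms by (simp add: d_def third flip: minus_act_right_mult)
  moreover have "\<xi> a \<otimes> inv (\<eta> (d \<leftharpoonup> \<xi> a)) = inv (\<eta> d) \<otimes> \<xi> (\<eta> d \<triangleright> a)"
  proof -
    have "\<xi> a \<otimes> inv (\<eta> (d \<leftharpoonup> \<xi> a)) = inv (\<eta> d) \<otimes> (\<eta> d \<otimes> \<xi> a) \<otimes> inv (\<eta> (d \<leftharpoonup> \<xi> a))"
      using assms d by (simp flip: m_assoc)
    also have "\<dots> = inv (\<eta> d) \<otimes> \<xi> (\<eta> d \<triangleright> a)"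
      using assms d by (simp add: m_assoc flip: eta_xi_commute)
    finally show ?thesis .
  qed
  ultimately show "\<xi> a \<otimes> inv (\<eta> (c \<leftharpoonup> \<xi> (\<eta> b \<triangleright> a) \<leftharpoonup> \<xi> (b \<leftharpoonup> \<xi> a))) =
      inv (\<eta> (c \<leftharpoonup> \<xi> b)) \<otimes> \<xi> (\<eta> (c \<leftharpoonup> \<xi> b) \<triangleright> a)"
    by (simp add: d_def)
qed

abbreviation "r12 \<equiv> H3.vec X3 (label12 R_label)"
abbreviation "r13 \<equiv> H3.vec X3 (label13 R_label)"
abbreviation "r23 \<equiv> H3.vec X3 (label23 R_label)"
abbreviation "r21 \<equiv> H3.vec X3 (label21 R_label)"
abbreviation "r31 \<equiv> H3.vec X3 (label31 R_label)"
abbreviation "r32 \<equiv> H3.vec X3 (label32 R_label)"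

lemmas r_closed = label_closed [OF R_label_closed]
lemmas r_inv_closed = label_closed [OF R_inv_label_closed]

text \<open>The Yang--Baxter equation for those three numberings of the legs that
  \<open>pseudotriangular_iff_commute\<close> uses. The underlying identities
  of labels are the same each time, at permuted objects.\<close>

lemma r_yang_baxter_312: "r31 \<otimes>\<^bsub>alg_monoid3 H\<^esub> r32 \<otimes>\<^bsub>alg_monoid3 H\<^esub> r12 = r12 \<otimes>\<^bsub>alg_monoid3 H\<^esub> r32 \<otimes>\<^bsub>alg_monoid3 H\<^esub> r31"
  unfolding H3.global_section_vec_mult3 [OF r_closed(5) r_closed(6) r_closed(1)]
    H3.global_section_vec_mult3 [OF r_closed(1) r_closed(6) r_closed(5)]
  by (rule H3.section_vec_cong [OF refl])
    (clarsimp simp: section_mult_def label_defs R_label_def minus_act_right_mult R_first_leg,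
      intro conjI label_yang_baxter)

lemma r_yang_baxter_231: "r23 \<otimes>\<^bsub>alg_monoid3 H\<^esub> r21 \<otimes>\<^bsub>alg_monoid3 H\<^esub> r31 = r31 \<otimes>\<^bsub>alg_monoid3 H\<^esub> r21 \<otimes>\<^bsub>alg_monoid3 H\<^esub> r23"
  unfolding H3.global_section_vec_mult3 [OF r_closed(3) r_closed(4) r_closed(5)]
    H3.global_section_vec_mult3 [OF r_closed(5) r_closed(4) r_closed(3)]
  by (rule H3.section_vec_cong [OF refl])
    (clarsimp simp: section_mult_def label_defs R_label_def minus_act_right_mult R_first_leg,
      intro conjI label_yang_baxter)

lemma r_yang_baxter_321: "r32 \<otimes>\<^bsub>alg_monoid3 H\<^esub> r31 \<otimes>\<^bsub>alg_monoid3 H\<^esub> r21 = r21 \<otimes>\<^bsub>alg_monoid3 H\<^esub> r31 \<otimes>\<^bsub>alg_monoid3 H\<^esub> r32"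
  unfolding H3.global_section_vec_mult3 [OF r_closed(6) r_closed(5) r_closed(4)]
    H3.global_section_vec_mult3 [OF r_closed(4) r_closed(5) r_closed(6)]
  by (rule H3.section_vec_cong [OF refl])
    (clarsimp simp: section_mult_def label_defs R_label_def minus_act_right_mult R_first_leg,
      intro conjI label_yang_baxter)

lemma R_right_inverse:
  "H2.vec X2 R_label \<otimes>\<^bsub>alg_monoid2 H\<^esub> H2.vec X2 R_inv_label = \<one>\<^bsub>alg_monoid2 H\<^esub>"
  unfolding H2.global_section_vec_mult [OF R_label_closed R_inv_label_closed] H2.one_eq_vec
  by (rule H2.section_vec_cong [OF refl])
    (clarsimp simp: section_mult_def R_label_def R_inv_label_def R_first_leg braiding_right_inverse)

lemma R_left_inverse:
  "H2.vec X2 R_inv_label \<otimes>\<^bsub>alg_monoid2 H\<^esub> H2.vec X2 R_label = \<one>\<^bsub>alg_monoid2 H\<^esub>"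
  unfolding H2.global_section_vec_mult [OF R_inv_label_closed R_label_closed] H2.one_eq_vec
  by (rule H2.section_vec_cong [OF refl])
    (clarsimp simp: section_mult_def R_label_def R_inv_label_def R_inv_target braiding_left_inverse)

section \<open>Quasitriangularity\<close>

text \<open>The coproduct of the arrow \<open>u \<otimes> x\<close> consists of one arrow for each factorization \<open>u = a \<otimes> b\<close> in
  \<open>Gplus\<close>, because \<open>x\<close> acts on the product \<open>a \<otimes> b\<close> through \<open>b \<rightharpoonup> x\<close> on \<open>a\<close> and \<open>x\<close> on \<open>b\<close>.\<close>

lemma basis_comult_eq:
  assumes "u \<in> Gplus G" "x \<in> Gminus G"
  shows "basis_comult H (u \<otimes> x) = H2.vec {p \<in> X2. fst p \<otimes> snd p = u} (\<lambda>(a, b). (b \<rightharpoonup> x, x))"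
proof
  fix z
  have bij: "bij_betw (\<lambda>h. (u \<otimes> inv h, h)) (Gplus G) {p \<in> X2. fst p \<otimes> snd p = u}"
    by (rule bij_betw_byWitness [where f' = snd]) (use assms in \<open>auto simp: m_assoc\<close>)
  have "basis_comult H (u \<otimes> x) z = (\<Sum>h\<in>Gplus G. basis_vec (u \<otimes> inv h \<otimes> (h \<rightharpoonup> x), h \<otimes> x) z)"
    using assms by (simp add: factorization_hopf_def tensor_basis_vec)
  also have "\<dots> = H2.vec {p \<in> X2. fst p \<otimes> snd p = u} (\<lambda>(a, b). (b \<rightharpoonup> x, x)) z"
    unfolding section_vec_def by (subst sum.reindex_bij_betw [OF bij, symmetric]) simp
  finally show "basis_comult H (u \<otimes> x) z = H2.vec {p \<in> X2. fst p \<otimes> snd p = u} (\<lambda>(a, b). (b \<rightharpoonup> x, x)) z" .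
qed

lemma opposite_basis_comult_eq:
  assumes "u \<in> Gplus G" "x \<in> Gminus G"
  shows "(\<lambda>(y, z). basis_comult H (u \<otimes> x) (z, y)) =
    H2.vec {p \<in> X2. snd p \<otimes> fst p = u} (\<lambda>(a, b). (x, a \<rightharpoonup> x))"
proof (rule ext, clarify)
  fix y z
  have bij: "bij_betw prod.swap {p \<in> X2. snd p \<otimes> fst p = u} {p \<in> X2. fst p \<otimes> snd p = u}"
    by (rule bij_betw_byWitness [where f' = prod.swap]) auto
  show "basis_comult H (u \<otimes> x) (z, y) = H2.vec {p \<in> X2. snd p \<otimes> fst p = u} (\<lambda>(a, b). (x, a \<rightharpoonup> x)) (y, z)"
    unfolding basis_comult_eq [OF assms] section_vec_def
    by (subst sum.reindex_bij_betw [OF bij, symmetric]) (auto simp: basis_vec_def intro!: sum.cong)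
qed

text \<open>The first labels of \<open>\<Delta>\<^sup>o\<^sup>p R\<close> and \<open>R \<Delta>\<close> at \<open>(p, q)\<close>; both orders end in the second leg at the point
  \<open>q \<leftharpoonup> (\<xi> p \<otimes> x)\<close>.\<close>

lemma eta_target_inverse:
  assumes "p \<in> Gplus G" "q \<in> Gplus G" "x \<in> Gminus G"
  shows "x \<otimes> inv (\<eta> (q \<leftharpoonup> (p \<rightharpoonup> x) \<leftharpoonup> \<xi> (p \<leftharpoonup> x))) = inv (\<eta> (q \<leftharpoonup> \<xi> p)) \<otimes> ((q \<leftharpoonup> \<xi> p) \<rightharpoonup> x)"
proof -
  define d where "d = q \<leftharpoonup> \<xi> p"
  have d: "d \<in> Gplus G" using assms by (simp add: d_def)
  have "q \<leftharpoonup> (p \<rightharpoonup> x) \<leftharpoonup> \<xi> (p \<leftharpoonup> x) = d \<leftharpoonup> x"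
    using assms by (simp add: d_def xi_harpoon flip: minus_act_right_mult)
  moreover have "x \<otimes> inv (\<eta> (d \<leftharpoonup> x)) = inv (\<eta> d) \<otimes> (d \<rightharpoonup> x)"
  proof -
    have "x \<otimes> inv (\<eta> (d \<leftharpoonup> x)) = inv (\<eta> d) \<otimes> (\<eta> d \<otimes> x) \<otimes> inv (\<eta> (d \<leftharpoonup> x))"
      using assms d by (simp flip: m_assoc)
    also have "\<dots> = inv (\<eta> d) \<otimes> (d \<rightharpoonup> x)"
      using assms d by (simp add: m_assoc flip: eta_harpoon)
    finally show ?thesis .
  qed
  ultimately show ?thesis by (simp add: d_def)
qed

text \<open>The domains agree because \<open>R\<close> moves the pairs \<open>(p, q)\<close> with \<open>q \<otimes> p = u\<close> to the pairs \<open>(a, b)\<close> with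
  \<open>a \<otimes> b = u\<close>, by \<open>braiding_inverse_mult\<close>.\<close>

lemma R_intertwines_basis:
  assumes "g \<in> carrier G"
  shows "H2.vec X2 R_label \<otimes>\<^bsub>alg_monoid2 H\<^esub> basis_comult H g =
    (\<lambda>(y, z). basis_comult H g (z, y)) \<otimes>\<^bsub>alg_monoid2 H\<^esub> H2.vec X2 R_label"
proof -
  obtain u x where ux: "u \<in> Gplus G" "x \<in> Gminus G" "g = u \<otimes> x"
    using factorization [OF assms] by blast
  have cl: "(\<lambda>(a, b). (b \<rightharpoonup> x, x)) \<in> X2 \<rightarrow> carrier (Gminus_group \<times>\<times> Gminus_group)"
    "(\<lambda>(a, b). (x, a \<rightharpoonup> x)) \<in> X2 \<rightarrow> carrier (Gminus_group \<times>\<times> Gminus_group)"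
    using ux by auto
  show ?thesis
    unfolding ux(3) opposite_basis_comult_eq [OF ux(1,2)]
    unfolding basis_comult_eq [OF ux(1,2)]
      H2.section_vec_mult [OF subset_refl Collect_restrict R_label_closed cl(1)]
      H2.section_vec_mult [OF Collect_restrict subset_refl cl(2) R_label_closed]
  proof (rule H2.section_vec_cong, goal_cases)
    case 1 show ?case
      using ux by (auto simp: R_label_def R_first_leg braiding_inverse_mult)
  next
    case (2 p)
    then obtain a b where p: "p = (a, b)" "a \<in> Gplus G" "b \<in> Gplus G" by auto
    show ?case unfolding p(1)
      using p(2,3) ux by (simp add: section_mult_def R_label_def R_first_leg xi_harpoon eta_target_inverse)
  qed
qed

lemma R_intertwines:
  "H2.vec X2 R_label \<otimes>\<^bsub>alg_monoid2 H\<^esub> comult H f = comult_op H f \<otimes>\<^bsub>alg_monoid2 H\<^esub> H2.vec X2 R_label"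
proof -
  have op: "comult_op H f = (\<lambda>p. \<Sum>a\<in>basis H. f a * (\<lambda>(y, z). basis_comult H a (z, y)) p)"
    by (auto simp: comult_op_def comult_def)
  have "basis H = carrier G" by (simp add: factorization_hopf_def)
  thus ?thesis
    unfolding op comult_def alg_monoid_mult_sum_right alg_monoid_mult_sum_left
    by (intro ext sum.cong refl) (simp add: R_intertwines_basis)
qed

lemma comult_op_closed: "comult_op H f \<in> carrier (alg_monoid2 H)"
proof -
  have "basis_comult H g (z, y) = 0" if g: "g \<in> basis H" and yz: "(y, z) \<notin> basis (tensor_alg H H)" for g y z
  proof -
    obtain u x where ux: "u \<in> Gplus G" "x \<in> Gminus G" "g = u \<otimes> x"
      using factorization [of g] g by (auto simp: factorization_hopf_def)
    have "(\<lambda>(y, z). basis_comult H g (z, y)) \<in> carrier (alg_monoid2 H)"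
      unfolding ux(3) opposite_basis_comult_eq [OF ux(1,2)]
      by (rule H2.section_vec_closed [OF Collect_restrict]) (use ux in auto)
    thus ?thesis using yz by (auto simp: alg_monoid_def)
  qed
  thus ?thesis by (auto simp: alg_monoid_def comult_op_def comult_def intro!: sum.neutral)
qed

text \<open>Summing over all \<open>u\<close> the partial sections on \<open>{(a, b). a \<otimes> b = u}\<close> gives a section on all pairs. This is
  how applying the coproduct to one leg of \<open>R\<close> gives a section again.\<close>

lemma sum_over_products:
  fixes F :: "'a \<times> 'a \<Rightarrow> complex"
  shows "(\<Sum>u\<in>Gplus G. \<Sum>p\<in>{p \<in> X2. fst p \<otimes> snd p = u}. F p) = (\<Sum>a\<in>Gplus G. \<Sum>b\<in>Gplus G. F (a, b))"
proof -
  have "(\<Sum>u\<in>Gplus G. \<Sum>p\<in>{p \<in> X2. fst p \<otimes> snd p = u}. F p) = (\<Sum>p\<in>X2. F p)"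
    using finite_Gplus by (intro sum.group) auto
  thus ?thesis by (simp add: sum.cartesian_product)
qed

lemma basis_comult_apply:
  assumes "u \<in> Gplus G" "x \<in> Gminus G"
  shows "basis_comult H (u \<otimes> x) (y, z) = (\<Sum>(a, b)\<in>{p \<in> X2. fst p \<otimes> snd p = u}.
    basis_vec (a \<otimes> (b \<rightharpoonup> x)) y * basis_vec (b \<otimes> x) z)"
  unfolding basis_comult_eq [OF assms] section_vec_def
  by (auto simp: basis_vec_def intro!: sum.cong)

text \<open>Applying the coproduct to the first leg gives at \<open>(a, b, c)\<close> the labels
  \<open>(b \<rightharpoonup> m, m, \<xi> (a \<otimes> b))\<close> with \<open>m = inv (\<eta> (c \<leftharpoonup> \<xi> (a \<otimes> b)))\<close>. The action in the first label is evaluated by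
  the second part of \<open>R_first_leg\<close>, as \<open>c\<close> is moved by \<open>\<xi> a\<close> first and by \<open>\<xi> b\<close> afterwards.\<close>

lemma comult_id_R: "comult_id H (H2.vec X2 R_label) = r13 \<otimes>\<^bsub>alg_monoid3 H\<^esub> r23"
proof -
  let ?P = "Gplus G" and ?D = "\<lambda>u. {p \<in> X2. fst p \<otimes> snd p = u}"
  let ?m = "\<lambda>u v. inv (\<eta> (v \<leftharpoonup> \<xi> u))"
  let ?t = "\<lambda>(a, b, c). (b \<rightharpoonup> ?m (a \<otimes> b) c, ?m (a \<otimes> b) c, \<xi> (a \<otimes> b))"
  let ?F = "\<lambda>x y z v (a, b). basis_vec (a \<otimes> (b \<rightharpoonup> ?m (a \<otimes> b) v)) x * basis_vec (b \<otimes> ?m (a \<otimes> b) v) y *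
      basis_vec (v \<otimes> \<xi> (a \<otimes> b)) z"
  have "comult_id H (H2.vec X2 R_label) = H3.vec X3 ?t"
  proof (rule ext, clarify)
    fix x y z
    have "comult_id H (H2.vec X2 R_label) (x, y, z) =
      (\<Sum>g\<in>basis H. (\<Sum>p\<in>X2. basis_vec (fst p \<otimes> ?m (fst p) (snd p)) g * basis_vec (snd p \<otimes> \<xi> (fst p)) z) *
        basis_comult H g (x, y))"
      by (simp only: comult_id_def prod.case vec2_apply) (simp add: R_label_def sum.cartesian_product split_def)
    also have "\<dots> = (\<Sum>p\<in>X2. basis_vec (snd p \<otimes> \<xi> (fst p)) z * basis_comult H (fst p \<otimes> ?m (fst p) (snd p)) (x, y))"
      by (intro sum_basis_vec_mult_weighted H1.finite_basis H2.finite_objects) (auto simp: factorization_hopf_def)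
    also have "\<dots> = (\<Sum>u\<in>?P. \<Sum>v\<in>?P. basis_vec (v \<otimes> \<xi> u) z * basis_comult H (u \<otimes> ?m u v) (x, y))"
      by (simp add: sum.cartesian_product split_def)
    also have "\<dots> = (\<Sum>u\<in>?P. \<Sum>v\<in>?P. \<Sum>p\<in>?D u. ?F x y z v p)"
      by (intro sum.cong refl) (auto simp: basis_comult_apply sum_distrib_left mult_ac intro!: sum.cong)
    also have "\<dots> = (\<Sum>v\<in>?P. \<Sum>a\<in>?P. \<Sum>b\<in>?P. ?F x y z v (a, b))"
      by (subst sum.swap) (simp only: sum_over_products)
    also have "\<dots> = (\<Sum>a\<in>?P. \<Sum>v\<in>?P. \<Sum>b\<in>?P. ?F x y z v (a, b))" by (rule sum.swap)
    also have "\<dots> = (\<Sum>a\<in>?P. \<Sum>b\<in>?P. \<Sum>v\<in>?P. ?F x y z v (a, b))" by (intro sum.cong refl sum.swap)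
    also have "\<dots> = H3.vec X3 ?t (x, y, z)" by (simp add: vec3_apply)
    finally show "comult_id H (H2.vec X2 R_label) (x, y, z) = H3.vec X3 ?t (x, y, z)" .
  qed
  also have "\<dots> = r13 \<otimes>\<^bsub>alg_monoid3 H\<^esub> r23"
    unfolding H3.global_section_vec_mult [OF r_closed(2) r_closed(3)]
    by (rule H3.section_vec_cong [OF refl])
      (clarsimp simp: section_mult_def label_defs R_label_def minus_act_right_mult R_first_leg xi_mult)
  finally show ?thesis .
qed

text \<open>Here the labels are \<open>(inv (\<eta> ((a \<otimes> b) \<leftharpoonup> \<xi> u)), b \<rightharpoonup> \<xi> u, \<xi> u)\<close>. The action of \<open>\<xi> u\<close> on the product \<open>a \<otimes> b\<close>
  splits, and \<open>b \<rightharpoonup> \<xi> u\<close> is \<open>\<xi>\<close> at the point to which \<open>R13\<close> moves \<open>u\<close>.\<close>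

lemma id_comult_R: "id_comult H (H2.vec X2 R_label) = r13 \<otimes>\<^bsub>alg_monoid3 H\<^esub> r12"
proof -
  let ?P = "Gplus G" and ?D = "\<lambda>u. {p \<in> X2. fst p \<otimes> snd p = u}"
  let ?m = "\<lambda>u v. inv (\<eta> (v \<leftharpoonup> \<xi> u))"
  let ?t = "\<lambda>(u, a, b). (?m u (a \<otimes> b), b \<rightharpoonup> \<xi> u, \<xi> u)"
  let ?F = "\<lambda>x y z u (a, b). basis_vec (u \<otimes> ?m u (a \<otimes> b)) x * basis_vec (a \<otimes> (b \<rightharpoonup> \<xi> u)) y *
      basis_vec (b \<otimes> \<xi> u) z"
  have "id_comult H (H2.vec X2 R_label) = H3.vec X3 ?t"
  proof (rule ext, clarify)
    fix x y z
    have "id_comult H (H2.vec X2 R_label) (x, y, z) =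
      (\<Sum>g\<in>basis H. (\<Sum>p\<in>X2. basis_vec (snd p \<otimes> \<xi> (fst p)) g * basis_vec (fst p \<otimes> ?m (fst p) (snd p)) x) *
        basis_comult H g (y, z))"
      by (simp only: id_comult_def prod.case vec2_apply)
        (simp add: R_label_def sum.cartesian_product split_def mult.commute)
    also have "\<dots> = (\<Sum>p\<in>X2. basis_vec (fst p \<otimes> ?m (fst p) (snd p)) x * basis_comult H (snd p \<otimes> \<xi> (fst p)) (y, z))"
      by (intro sum_basis_vec_mult_weighted H1.finite_basis H2.finite_objects) (auto simp: factorization_hopf_def)
    also have "\<dots> = (\<Sum>u\<in>?P. \<Sum>v\<in>?P. basis_vec (u \<otimes> ?m u v) x * basis_comult H (v \<otimes> \<xi> u) (y, z))"
      by (simp add: sum.cartesian_product split_def)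
    also have "\<dots> = (\<Sum>u\<in>?P. \<Sum>v\<in>?P. \<Sum>p\<in>?D v. ?F x y z u p)"
      by (intro sum.cong refl) (auto simp: basis_comult_apply sum_distrib_left mult_ac intro!: sum.cong)
    also have "\<dots> = (\<Sum>u\<in>?P. \<Sum>a\<in>?P. \<Sum>b\<in>?P. ?F x y z u (a, b))"
      by (simp only: sum_over_products)
    also have "\<dots> = H3.vec X3 ?t (x, y, z)" by (simp add: vec3_apply)
    finally show "id_comult H (H2.vec X2 R_label) (x, y, z) = H3.vec X3 ?t (x, y, z)" .
  qed
  also have "\<dots> = r13 \<otimes>\<^bsub>alg_monoid3 H\<^esub> r12"
    unfolding H3.global_section_vec_mult [OF r_closed(2) r_closed(1)]
    by (rule H3.section_vec_cong [OF refl])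
      (clarsimp simp: section_mult_def label_defs R_label_def minus_act_right_mult R_first_leg
        xi_braiding_inverse mult_minus_act_right eta_mult inv_mult_group)
  finally show ?thesis .
qed

lemma inv_R: "inv\<^bsub>alg_monoid2 H\<^esub> (H2.vec X2 R_label) = H2.vec X2 R_inv_label"
proof -
  interpret M: monoid "alg_monoid2 H" by (rule H2.monoid_alg_monoid)
  show ?thesis
    by (rule M.inv_unique' [OF _ _ R_right_inverse R_left_inverse, symmetric])
      (rule H2.section_vec_closed [OF subset_refl], rule R_label_closed R_inv_label_closed)+
qed

lemma R_quasitriangular: "quasitriangular H (R_elem G \<xi> \<eta>)"
proof -
  let ?M = "alg_monoid2 H" and ?R = "H2.vec X2 R_label"
  interpret M: monoid ?M by (rule H2.monoid_alg_monoid)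
  have R: "?R \<in> carrier ?M" and S: "H2.vec X2 R_inv_label \<in> carrier ?M"
    by (rule H2.section_vec_closed [OF subset_refl], rule R_label_closed R_inv_label_closed)+
  have unit: "?R \<in> Units ?M"
    using R S R_right_inverse R_left_inverse by (auto simp: Units_def)
  have "comult_op H f = ?R \<otimes>\<^bsub>?M\<^esub> comult H f \<otimes>\<^bsub>?M\<^esub> inv\<^bsub>?M\<^esub> ?R" for f
  proof -
    have "comult_op H f \<in> carrier ?M" by (rule comult_op_closed)
    hence "comult_op H f = comult_op H f \<otimes>\<^bsub>?M\<^esub> ?R \<otimes>\<^bsub>?M\<^esub> inv\<^bsub>?M\<^esub> ?R"
      using R S by (simp add: inv_R M.m_assoc R_right_inverse)
    thus ?thesis by (simp add: R_intertwines)
  qed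
  thus ?thesis
    using unit by (simp add: quasitriangular_def R_elem_eq comult_id_R id_comult_R leg12_vec leg13_vec leg23_vec)
qed

section \<open>The monodromy element and pseudotriangularity\<close>

abbreviation "r31_inv \<equiv> H3.vec X3 (label31 R_inv_label)"

lemma r_Units:
  "r12 \<in> Units (alg_monoid3 H)" "r21 \<in> Units (alg_monoid3 H)" "r23 \<in> Units (alg_monoid3 H)"
  "r32 \<in> Units (alg_monoid3 H)" "r31 \<in> Units (alg_monoid3 H)"
  and inv_r31: "inv\<^bsub>alg_monoid3 H\<^esub> r31 = r31_inv"
proof -
  let ?M = "alg_monoid3 H"
  interpret M: monoid ?M by (rule H3.monoid_alg_monoid)
  let ?inverse = "\<lambda>place. H3.vec X3 (place R_label) \<otimes>\<^bsub>?M\<^esub> H3.vec X3 (place R_inv_label) = \<one>\<^bsub>?M\<^esub> \<and>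
    H3.vec X3 (place R_inv_label) \<otimes>\<^bsub>?M\<^esub> H3.vec X3 (place R_label) = \<one>\<^bsub>?M\<^esub>"
  note mult = H3.global_section_vec_mult [OF r_closed(1) r_inv_closed(1)]
    H3.global_section_vec_mult [OF r_inv_closed(1) r_closed(1)]
    H3.global_section_vec_mult [OF r_closed(3) r_inv_closed(3)]
    H3.global_section_vec_mult [OF r_inv_closed(3) r_closed(3)]
    H3.global_section_vec_mult [OF r_closed(4) r_inv_closed(4)]
    H3.global_section_vec_mult [OF r_inv_closed(4) r_closed(4)]
    H3.global_section_vec_mult [OF r_closed(5) r_inv_closed(5)]
    H3.global_section_vec_mult [OF r_inv_closed(5) r_closed(5)]
    H3.global_section_vec_mult [OF r_closed(6) r_inv_closed(6)]
    H3.global_section_vec_mult [OF r_inv_closed(6) r_closed(6)]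
  have inverse: "?inverse label12" "?inverse label21" "?inverse label23" "?inverse label32" "?inverse label31"
    unfolding mult H3.one_eq_vec
    by (intro conjI; rule H3.section_vec_cong [OF refl]; clarsimp simp: section_mult_def label_defs R_label_def
      R_inv_label_def R_first_leg braiding_right_inverse R_inv_target braiding_left_inverse)+
  have closed: "H3.vec X3 \<sigma> \<in> carrier ?M"
    if "\<sigma> \<in> X3 \<rightarrow> carrier (Gminus_group \<times>\<times> Gminus_group \<times>\<times> Gminus_group)" for \<sigma>
    using that by (rule H3.section_vec_closed [OF subset_refl])
  have unitI: "x \<in> Units ?M"
    if "x \<in> carrier ?M" "y \<in> carrier ?M" "x \<otimes>\<^bsub>?M\<^esub> y = \<one>\<^bsub>?M\<^esub> \<and> y \<otimes>\<^bsub>?M\<^esub> x = \<one>\<^bsub>?M\<^esub>" for x y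
    unfolding Units_def using that by blast
  show "r12 \<in> Units ?M"
    by (rule unitI [OF closed [OF r_closed(1)] closed [OF r_inv_closed(1)] inverse(1)])
  show "r21 \<in> Units ?M"
    by (rule unitI [OF closed [OF r_closed(4)] closed [OF r_inv_closed(4)] inverse(2)])
  show "r23 \<in> Units ?M"
    by (rule unitI [OF closed [OF r_closed(3)] closed [OF r_inv_closed(3)] inverse(3)])
  show "r32 \<in> Units ?M"
    by (rule unitI [OF closed [OF r_closed(6)] closed [OF r_inv_closed(6)] inverse(4)])
  show "r31 \<in> Units ?M"
    by (rule unitI [OF closed [OF r_closed(5)] closed [OF r_inv_closed(5)] inverse(5)])
  show "inv\<^bsub>?M\<^esub> r31 = r31_inv"
    by (rule M.inv_unique' [OF closed [OF r_closed(5)] closed [OF r_inv_closed(5)]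
        conjunct1 [OF inverse(5)] conjunct2 [OF inverse(5)], symmetric])
qed

text \<open>The group in question is the group of units of the third tensor power.\<close>

lemma pseudotriangular_iff_commute_r:
  "pseudotriangular H (R_elem G \<xi> \<eta>) \<longleftrightarrow>
    (r12 \<otimes>\<^bsub>alg_monoid3 H\<^esub> r21) \<otimes>\<^bsub>alg_monoid3 H\<^esub> (r23 \<otimes>\<^bsub>alg_monoid3 H\<^esub> r32) =
    (r23 \<otimes>\<^bsub>alg_monoid3 H\<^esub> r32) \<otimes>\<^bsub>alg_monoid3 H\<^esub> (r12 \<otimes>\<^bsub>alg_monoid3 H\<^esub> r21)"
proof -
  let ?M = "alg_monoid3 H"
  interpret M: monoid ?M by (rule H3.monoid_alg_monoid)
  interpret U: group "units_of ?M" by (rule M.units_group)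
  have "pseudotriangular H (R_elem G \<xi> \<eta>) \<longleftrightarrow>
      r12 \<otimes>\<^bsub>?M\<^esub> inv\<^bsub>?M\<^esub> r31 \<otimes>\<^bsub>?M\<^esub> r23 = r23 \<otimes>\<^bsub>?M\<^esub> inv\<^bsub>?M\<^esub> r31 \<otimes>\<^bsub>?M\<^esub> r12"
    using R_quasitriangular unfolding pseudotriangular_def inv_r31
    by (simp only: R_elem_eq inv_R leg12_vec leg23_vec leg31_vec simp_thms)
  also have "\<dots> \<longleftrightarrow> (r12 \<otimes>\<^bsub>?M\<^esub> r21) \<otimes>\<^bsub>?M\<^esub> (r23 \<otimes>\<^bsub>?M\<^esub> r32) = (r23 \<otimes>\<^bsub>?M\<^esub> r32) \<otimes>\<^bsub>?M\<^esub> (r12 \<otimes>\<^bsub>?M\<^esub> r21)"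
    by (rule U.pseudotriangular_iff_commute [unfolded units_of_carrier units_of_mult,
          of r12 r21 r23 r32 r31, unfolded M.units_of_inv [OF r_Units(5)]])
      (rule r_Units r_yang_baxter_312 r_yang_baxter_231 r_yang_baxter_321)+
  finally show ?thesis .
qed

text \<open>The labels of \<open>R R21\<close>, written with the actions \<open>\<triangleleft>\<close> and \<open>\<triangleright>\<close> rather than in the shorter form of
  \<open>R_label\<close>.\<close>

definition Q_label :: "'a \<times> 'a \<Rightarrow> 'a \<times> 'a" where
  "Q_label = (\<lambda>(u, v). (inv (\<eta> v \<triangleleft> u) \<otimes> \<xi> (v \<leftharpoonup> \<xi> u), \<xi> u \<otimes> inv (\<eta> (\<eta> v \<triangleright> u) \<triangleleft> (v \<leftharpoonup> \<xi> u))))"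

lemma Q_label_closed: "Q_label \<in> X2 \<rightarrow> carrier (Gminus_group \<times>\<times> Gminus_group)"
  by (auto simp: Q_label_def)

lemma r12_mult_r21: "r12 \<otimes>\<^bsub>alg_monoid3 H\<^esub> r21 = H3.vec X3 (label12 Q_label)"
  unfolding H3.global_section_vec_mult [OF r_closed(1) r_closed(4)]
  by (rule H3.section_vec_cong [OF refl])
    (clarsimp simp: section_mult_def label_defs R_label_def Q_label_def R_first_leg
      simp flip: eta_braiding_inverse)

lemma r23_mult_r32: "r23 \<otimes>\<^bsub>alg_monoid3 H\<^esub> r32 = H3.vec X3 (label23 Q_label)"
  unfolding H3.global_section_vec_mult [OF r_closed(3) r_closed(6)]
  by (rule H3.section_vec_cong [OF refl])
    (clarsimp simp: section_mult_def label_defs R_label_def Q_label_def R_first_leg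
      simp flip: eta_braiding_inverse)

text \<open>Starting at \<open>(s, u, v)\<close>, the first product moves \<open>u\<close> by \<open>Q12\<close> to \<open>c\<close> before \<open>Q23\<close> is read, and the second
  one moves \<open>u\<close> by \<open>Q23\<close> to \<open>t\<close> before \<open>Q12\<close> is read. Only the middle object is shared by the two
  placements.\<close>

lemma Q_commute_iff:
  "H3.vec X3 (label12 Q_label) \<otimes>\<^bsub>alg_monoid3 H\<^esub> H3.vec X3 (label23 Q_label) =
    H3.vec X3 (label23 Q_label) \<otimes>\<^bsub>alg_monoid3 H\<^esub> H3.vec X3 (label12 Q_label) \<longleftrightarrow>
    (\<forall>u\<in>Gplus G. \<forall>v\<in>Gplus G. \<forall>s\<in>Gplus G.
      let t = u \<leftharpoonup> fst (Q_label (u, v)); c = u \<leftharpoonup> snd (Q_label (s, u)) in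
        snd (Q_label (u, v)) = snd (Q_label (c, v)) \<and>
        fst (Q_label (u, v)) \<otimes> snd (Q_label (s, t)) = snd (Q_label (s, u)) \<otimes> fst (Q_label (c, v)) \<and>
        fst (Q_label (s, t)) = fst (Q_label (s, u)))"
proof -
  let ?m = "section_mult (Gminus_group \<times>\<times> Gminus_group \<times>\<times> Gminus_group)
    (\<lambda>(p, qr) (k, lm). (p \<leftharpoonup> k, (\<lambda>(p, q) (k, l). (p \<leftharpoonup> k, q \<leftharpoonup> l)) qr lm))"
  note cl = label_closed(1,3) [OF Q_label_closed]
  have Q: "fst (Q_label (p, q)) \<in> Gminus G" "snd (Q_label (p, q)) \<in> Gminus G"
    if "p \<in> Gplus G" "q \<in> Gplus G" for p q
    using that by (auto simp: Q_label_def)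
  have left: "?m (label12 Q_label) (label23 Q_label) (s, u, v) =
      (fst (Q_label (s, u)), snd (Q_label (s, u)) \<otimes> fst (Q_label (u \<leftharpoonup> snd (Q_label (s, u)), v)),
        snd (Q_label (u \<leftharpoonup> snd (Q_label (s, u)), v)))"
    and right: "?m (label23 Q_label) (label12 Q_label) (s, u, v) =
      (fst (Q_label (s, u \<leftharpoonup> fst (Q_label (u, v)))),
        fst (Q_label (u, v)) \<otimes> snd (Q_label (s, u \<leftharpoonup> fst (Q_label (u, v)))), snd (Q_label (u, v)))"
    if "s \<in> Gplus G" "u \<in> Gplus G" "v \<in> Gplus G" for s u v
    using that by (simp_all add: section_mult_def label_defs Q del: prod.collapse)
  have triples: "(\<forall>p\<in>X3. P p) \<longleftrightarrow> (\<forall>u\<in>Gplus G. \<forall>v\<in>Gplus G. \<forall>s\<in>Gplus G. P (s, u, v))" for P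
    by blast
  show ?thesis
    unfolding H3.global_section_vec_mult [OF cl] H3.global_section_vec_mult [OF cl(2) cl(1)]
      H3.section_vec_eq_iff [OF H3.section_mult_closed [OF cl] H3.section_mult_closed [OF cl(2) cl(1)]]
    unfolding triples Let_def
  proof (intro ball_cong refl)
    fix u v s assume uvs: "u \<in> Gplus G" "v \<in> Gplus G" "s \<in> Gplus G"
    show "?m (label12 Q_label) (label23 Q_label) (s, u, v) = ?m (label23 Q_label) (label12 Q_label) (s, u, v) \<longleftrightarrow>
      snd (Q_label (u, v)) = snd (Q_label (u \<leftharpoonup> snd (Q_label (s, u)), v)) \<and>
      fst (Q_label (u, v)) \<otimes> snd (Q_label (s, u \<leftharpoonup> fst (Q_label (u, v)))) =
        snd (Q_label (s, u)) \<otimes> fst (Q_label (u \<leftharpoonup> snd (Q_label (s, u)), v)) \<and>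
      fst (Q_label (s, u \<leftharpoonup> fst (Q_label (u, v)))) = fst (Q_label (s, u))"
      unfolding left [OF uvs(3,1,2)] right [OF uvs(3,1,2)] prod.inject by (auto simp del: prod.collapse)
  qed
qed

end

theorem proposition4p2:
  fixes G :: "('a, 'm) factored_group_scheme" (structure)
    and \<xi> \<eta> :: "'a \<Rightarrow> 'a"
  assumes "unique_factorization G" and "finite (carrier G)"
    and "\<xi> \<in> hom (G\<lparr>carrier := Gplus G\<rparr>) (G\<lparr>carrier := Gminus G\<rparr>)"
    and "\<eta> \<in> hom (G\<lparr>carrier := Gplus G\<rparr>) (G\<lparr>carrier := Gminus G\<rparr>)"
    and "\<And>u v. u \<in> Gplus G \<Longrightarrow> v \<in> Gplus G \<Longrightarrow> \<xi> u \<triangleleft> v = \<xi> (u \<leftharpoonup> \<eta> v)"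
    and "\<And>u v. u \<in> Gplus G \<Longrightarrow> v \<in> Gplus G \<Longrightarrow> u \<rightharpoonup> \<eta> v = \<eta> (\<xi> u \<triangleright> v)"
    and "\<And>u v. u \<in> Gplus G \<Longrightarrow> v \<in> Gplus G \<Longrightarrow> u \<otimes> v = (\<xi> u \<triangleright> v) \<otimes> (u \<leftharpoonup> \<eta> v)"
    and "\<And>u x. u \<in> Gplus G \<Longrightarrow> x \<in> Gminus G \<Longrightarrow> \<xi> (x \<triangleright> u) \<otimes> (x \<triangleleft> u) = x \<otimes> \<xi> u"
    and "\<And>u x. u \<in> Gplus G \<Longrightarrow> x \<in> Gminus G \<Longrightarrow> \<eta> (x \<triangleright> u) \<otimes> (x \<triangleleft> u) = x \<otimes> \<eta> u"
  shows "pseudotriangular (factorization_hopf G) (R_elem G \<xi> \<eta>) \<longleftrightarrow>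
    (\<forall>u\<in>Gplus G. \<forall>v\<in>Gplus G. \<forall>s\<in>Gplus G.
      let t = u \<leftharpoonup> (inv (\<eta> v \<triangleleft> u) \<otimes> \<xi> (v \<leftharpoonup> \<xi> u));
          c = u \<leftharpoonup> (\<xi> s \<otimes> inv (\<eta> (\<eta> u \<triangleright> s) \<triangleleft> (u \<leftharpoonup> \<xi> s)))
      in
        \<xi> u \<otimes> inv (\<eta> (\<eta> v \<triangleright> u) \<triangleleft> (v \<leftharpoonup> \<xi> u)) =
          \<xi> c \<otimes> inv (\<eta> (\<eta> v \<triangleright> c) \<triangleleft> (v \<leftharpoonup> \<xi> c)) \<and>
        inv (\<eta> v \<triangleleft> u) \<otimes> \<xi> (v \<leftharpoonup> \<xi> u) \<otimes> \<xi> s \<otimes> inv (\<eta> (\<eta> t \<triangleright> s) \<triangleleft> (t \<leftharpoonup> \<xi> s)) =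
          \<xi> s \<otimes> inv (\<eta> (\<eta> u \<triangleright> s) \<triangleleft> (u \<leftharpoonup> \<xi> s)) \<otimes> inv (\<eta> v \<triangleleft> c) \<otimes> \<xi> (v \<leftharpoonup> \<xi> c) \<and>
        inv (\<eta> t \<triangleleft> s) \<otimes> \<xi> (t \<leftharpoonup> \<xi> s) = inv (\<eta> u \<triangleleft> s) \<otimes> \<xi> (u \<leftharpoonup> \<xi> s))"
proof -
  interpret F: unique_factorization G by fact
  interpret braided_factorization G \<xi> \<eta>
    by unfold_locales (use assms in auto)
  have "fst (Q_label (u, v)) \<otimes> snd (Q_label (s, t)) =
      inv (\<eta> v \<triangleleft> u) \<otimes> \<xi> (v \<leftharpoonup> \<xi> u) \<otimes> \<xi> s \<otimes> inv (\<eta> (\<eta> t \<triangleright> s) \<triangleleft> (t \<leftharpoonup> \<xi> s))"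
    "snd (Q_label (s, u)) \<otimes> fst (Q_label (c, v)) =
      \<xi> s \<otimes> inv (\<eta> (\<eta> u \<triangleright> s) \<triangleleft> (u \<leftharpoonup> \<xi> s)) \<otimes> inv (\<eta> v \<triangleleft> c) \<otimes> \<xi> (v \<leftharpoonup> \<xi> c)"
    if "u \<in> Gplus G" "v \<in> Gplus G" "s \<in> Gplus G" "t \<in> Gplus G" "c \<in> Gplus G" for u v s t c
    using that by (simp_all add: Q_label_def F.m_assoc)
  thus ?thesis
    unfolding pseudotriangular_iff_commute_r r12_mult_r21 r23_mult_r32 Q_commute_iff
    by (simp add: Let_def Q_label_def cong: ball_cong)
qed

end
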